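(* Let $n\ge 1$ and let $a(s)=s^n+a_1s^{n-1}+\cdots+a_n\in H^n$ and $b(s)=s^n+b_1s^{n-1}+\cdots+b_n\in H^n$. Then there exists a polynomial $c(s)$ with real coefficients such that $c(s)/a(s)$ and $c(s)/b(s)$ are both strictly positive real if and only if $$\lambda b(s)+(1-\lambda)a(s)\in H^n\quad\text{for all }\lambda\in[0,1].$$
   Context: $P^n$ denotes the set of polynomials in $s$ of order (degree) $n$ with real coefficients, and $\partial(p)$ denotes the order (degree) of a polynomial $p$. $H^n\subset P^n$ denotes the set of Hurwitz stable polynomials of order $n$ with real coefficients (all roots have negative real part). Here $j=\sqrt{-1}$ in $j\omega$. Definition (strictly positive real, SPR). Let $p\in P^m$, $q\in P^n$ and $f(s)=p(s)/q(s)$. Then $f(s)$ is said to be strictly positive real if (i) $\partial(p)=\partial(q)$; (ii) $f(s)$ is analytic in $\mathrm{Re}[s]\ge 0$ (namely, $q\in H^n$); (iii) $\mathrm{Re}[f(j\omega)]>0$ for all $\omega\in\mathbb{R}$. *)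

theory Defs
  imports Complex_Main "HOL-Computational_Algebra.Polynomial"
begin

definition polys_of_degree :: "nat \<Rightarrow> real poly set" where
  "polys_of_degree n = {p. degree p = n}"

definition ceval :: "real poly \<Rightarrow> complex \<Rightarrow> complex" where
  "ceval p s = poly (map_poly complex_of_real p) s"

(* The root condition excludes the zero polynomial, whose degree is 0 in the library. *)
definition hurwitz_polys :: "nat \<Rightarrow> real poly set" where
  "hurwitz_polys n = {p \<in> polys_of_degree n. \<forall>s. ceval p s = 0 \<longrightarrow> Re s < 0}"

(* p / q is taken as the given pair (p, q), without cancelling common factors; analyticity
   in the closed right half-plane is, as in the source, the Hurwitz stability of q. *)
definition strictly_positive_real :: "real poly \<Rightarrow> real poly \<Rightarrow> bool" where
  "strictly_positive_real p q \<longleftrightarrow>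
     degree p = degree q \<and>
     q \<in> hurwitz_polys (degree q) \<and>
     (\<forall>\<omega>::real. Re (ceval p (\<i> * complex_of_real \<omega>) / ceval q (\<i> * complex_of_real \<omega>)) > 0)"

end

theory Submission
  imports
    Defs
    "HOL-Complex_Analysis.Conformal_Mappings"
    "HOL-Computational_Algebra.Polynomial_Factorial"
    "HOL-Computational_Algebra.Field_as_Ring"
    "HOL-Computational_Algebra.Fundamental_Theorem_Algebra"
begin

text \<open>
  The Cayley substitution \<open>s = (1 + z) / (1 - z)\<close> carries the closed right half-plane together with
  infinity to the closed unit disc, and a polynomial \<open>p(s)\<close> of degree at most \<open>n\<close> to the polynomial
  \<open>(1 - z)^n p(s)\<close>. Infinity becomes the ordinary boundary point \<open>z = 1\<close>, which absorbs the degree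
  conditions. With \<open>A, B, C\<close> denoting the transforms of \<open>a, b, c\<close>, the theorem says: there is \<open>C\<close> of
  degree at most \<open>n\<close> with \<open>Re (C * cnj A) > 0\<close> and \<open>Re (C * cnj B) > 0\<close> on the unit circle iff no
  \<open>(1 - t) A + t B\<close>, \<open>0 \<le> t \<le> 1\<close>, vanishes in the closed disc. (A complex \<open>c\<close> that works for real
  \<open>a\<close> and \<open>b\<close> may be replaced by the real part of its coefficients.)

  Necessity is the maximum principle: \<open>Re (C / A)\<close> and \<open>Re (C / B)\<close> are harmonic and positive on the
  circle, hence positive on the disc, and so \<open>Re (C * cnj ((1 - t) A + t B)) > 0\<close> there.

  For sufficiency, \<open>B\<close> is reached from \<open>A\<close> along the segment \<open>B\<^sub>t = (1 - t) A + t B\<close>; for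
  \<open>t = 0\<close> the multiplier \<open>C = A\<close> works. The parameters that admit a multiplier form an open set because
  the circle is compact. At the supremum of such parameters, normalized multipliers accumulate at some
  \<open>C \<noteq> 0\<close> for which both inequalities hold in the weak sense, and the point is to perturb it into
  one for which they are strict (\<open>strict_perturbation\<close>). This needs \<open>E\<close> of degree at most \<open>n\<close> with
  \<open>Re (E * cnj A) > 0\<close> at the zeros of \<open>Re (C * cnj A)\<close> and \<open>Re (E * cnj B) > 0\<close> at the zeros of
  \<open>Re (C * cnj B)\<close>, and such an \<open>E\<close> exists by a count of zeros. Both real parts are nonnegative
  trigonometric polynomials of degree \<open>n\<close>, so their zeros are double and there are at most \<open>n\<close> of each,
  \<open>2 n\<close> in all. At a point where \<open>C * cnj A\<close> is imaginary and nonzero, the demand on \<open>E\<close> is a sign of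
  \<open>Im (E / C)\<close>, and \<open>Im (E / C)\<close> can be prescribed at \<open>2 n\<close> points of the circle when \<open>C\<close> has no zero
  in the disc (\<open>Im_quotient_interpolation\<close>). At a common zero, \<open>A\<close> and \<open>B\<close> are real multiples of each
  other; since the segment between them avoids \<open>0\<close>, the multiple is positive and the two demands agree.
  If \<open>C\<close> does vanish in the disc, then its zeros are simple and lie on the circle; each costs one degree
  of freedom, but it also uses up one zero of each of the two real parts.
\<close>

section \<open>The maximum principle for pairs of polynomials\<close>

text \<open>
  The sign of \<open>Re (C * cnj A)\<close> is that of \<open>Re (C / A)\<close>, the real part of a holomorphic function. The
  version with \<open>cnj\<close> is the useful one, as it is real-linear in each of \<open>C\<close> and \<open>A\<close>.
\<close>

lemma Re_mult_cnj_nonneg_on_disc: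
  assumes A: "\<And>z. z \<in> cball 0 1 \<Longrightarrow> poly A z \<noteq> 0"
    and bd: "\<And>z. z \<in> sphere 0 1 \<Longrightarrow> Re (poly C z * cnj (poly A z)) \<ge> 0"
    and z: "z \<in> cball 0 1"
  shows "Re (poly C z * cnj (poly A z)) \<ge> 0"
proof -
  have "Re (- (poly C z / poly A z)) \<le> 0"
  proof (rule maximum_real_frontier[where S = "cball 0 1" and f = "\<lambda>z. - (poly C z / poly A z)" and \<xi> = z])
    show "(\<lambda>z. - (poly C z / poly A z)) holomorphic_on interior (cball 0 1)"
      using A by (intro holomorphic_intros) auto
    show "continuous_on (closure (cball 0 1)) (\<lambda>z. - (poly C z / poly A z))"
      using A by (intro continuous_intros) auto
    show "Re (- (poly C w / poly A w)) \<le> 0" if "w \<in> frontier (cball 0 1)" for w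
      using bd[of w] that Re_complex_div_ge_0[of "poly C w" "poly A w"]
      by (simp del: times_complex.sel)
  qed (use z in auto)
  thus ?thesis using Re_complex_div_ge_0[of "poly C z" "poly A z"] by (simp del: times_complex.sel)
qed

text \<open>
  By compactness \<open>Re (C / A) \<ge> d > 0\<close> on the circle; the weak version then applies to \<open>C - d A\<close>.
\<close>

lemma Re_mult_cnj_pos_on_disc:
  assumes A: "\<And>z. z \<in> cball 0 1 \<Longrightarrow> poly A z \<noteq> 0"
    and bd: "\<And>z. z \<in> sphere 0 1 \<Longrightarrow> Re (poly C z * cnj (poly A z)) > 0"
    and z: "z \<in> cball 0 1"
  shows "Re (poly C z * cnj (poly A z)) > 0"
proof -
  have ne: "poly A w \<noteq> 0" if "w \<in> sphere 0 1" for w using A[of w] that by auto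
  have "\<exists>w\<in>sphere 0 1. \<forall>v\<in>sphere 0 (1::real).
      Re (poly C w * cnj (poly A w)) / (cmod (poly A w))\<^sup>2 \<le> Re (poly C v * cnj (poly A v)) / (cmod (poly A v))\<^sup>2"
    using ne by (intro continuous_attains_inf continuous_intros) auto
  then obtain w where w: "w \<in> sphere 0 1" and min: "\<And>v. v \<in> sphere 0 1 \<Longrightarrow>
      Re (poly C w * cnj (poly A w)) / (cmod (poly A w))\<^sup>2 \<le> Re (poly C v * cnj (poly A v)) / (cmod (poly A v))\<^sup>2"
    by blast
  define d where "d = Re (poly C w * cnj (poly A w)) / (cmod (poly A w))\<^sup>2"
  have d: "d > 0" unfolding d_def using bd[OF w] ne[OF w] by simp
  have shift: "Re (poly (C - smult (of_real d) A) v * cnj (poly A v))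
       = Re (poly C v * cnj (poly A v)) - d * (cmod (poly A v))\<^sup>2" for v
  proof -
    have "poly (C - smult (of_real d) A) v * cnj (poly A v)
        = poly C v * cnj (poly A v) - of_real (d * (cmod (poly A v))\<^sup>2)"
      by (simp only: of_real_mult complex_norm_square) (simp add: algebra_simps)
    thus ?thesis by simp
  qed
  have "Re (poly (C - smult (of_real d) A) z * cnj (poly A z)) \<ge> 0"
  proof (rule Re_mult_cnj_nonneg_on_disc[OF A _ z])
    fix v :: complex assume v: "v \<in> sphere 0 1"
    have "d * (cmod (poly A v))\<^sup>2 \<le> Re (poly C v * cnj (poly A v))"
      using min[OF v, folded d_def] ne[OF v] by (simp add: pos_le_divide_eq)
    thus "Re (poly (C - smult (of_real d) A) v * cnj (poly A v)) \<ge> 0"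
      unfolding shift by simp
  qed auto
  moreover have "d * (cmod (poly A z))\<^sup>2 > 0" using d A[OF z] by simp
  ultimately show ?thesis unfolding shift by linarith
qed

section \<open>Prescribing the imaginary part of a quotient on the circle\<close>

text \<open>
  This is \<open>z^n * cnj (p (1 / cnj z))\<close>: it turns \<open>cnj p\<close> on the unit circle into a polynomial. The
  number \<open>n\<close> is a parameter rather than the degree, because the polynomials here are only known to have
  degree at most \<open>n\<close>.
\<close>

definition conj_reciprocal :: "nat \<Rightarrow> complex poly \<Rightarrow> complex poly" where
  "conj_reciprocal n p = (\<Sum>k\<le>n. monom (cnj (coeff p k)) (n - k))"

lemma degree_conj_reciprocal_le: "degree (conj_reciprocal n p) \<le> n"
  unfolding conj_reciprocal_def
  by (intro degree_sum_le) (auto intro: order_trans[OF degree_monom_le])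

lemma coeff_conj_reciprocal_top: "coeff (conj_reciprocal n p) n = cnj (coeff p 0)"
proof -
  have "coeff (conj_reciprocal n p) n = (\<Sum>k\<le>n. if k = 0 then cnj (coeff p 0) else 0)"
    unfolding conj_reciprocal_def coeff_sum by (intro sum.cong) auto
  thus ?thesis by simp
qed

lemma poly_as_sum_atMost:
  fixes p :: "'a :: comm_semiring_1 poly"
  assumes "degree p \<le> n"
  shows "poly p x = (\<Sum>k\<le>n. coeff p k * x ^ k)"
  by (subst poly_as_sum_of_monoms'[OF assms, symmetric]) (simp add: poly_sum poly_monom)

lemma poly_conj_reciprocal:
  assumes "degree p \<le> n" "z \<noteq> 0"
  shows "poly (conj_reciprocal n p) z = z ^ n * cnj (poly p (inverse (cnj z)))"
proof -
  have "poly (conj_reciprocal n p) z = (\<Sum>k\<le>n. cnj (coeff p k) * z ^ (n - k))"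
    by (simp add: conj_reciprocal_def poly_sum poly_monom)
  also have "\<dots> = (\<Sum>k\<le>n. z ^ n * (cnj (coeff p k) * inverse z ^ k))"
    using assms(2) by (intro sum.cong) (auto simp: power_diff field_simps)
  also have "\<dots> = z ^ n * cnj (poly p (inverse (cnj z)))"
    by (simp add: poly_as_sum_atMost[OF assms(1)] sum_distrib_left)
  finally show ?thesis .
qed

lemma poly_conj_reciprocal_sphere:
  assumes "degree p \<le> n" "cmod z = 1"
  shows "poly (conj_reciprocal n p) z = z ^ n * cnj (poly p z)"
proof -
  have "z * cnj z = 1" using assms(2) by (simp add: complex_norm_square[symmetric])
  hence "inverse (cnj z) = z" by (metis inverse_unique mult.commute)
  moreover have "z \<noteq> 0" using assms(2) by auto
  ultimately show ?thesis using poly_conj_reciprocal[OF assms(1), of z] by simp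
qed

lemma coprime_if_no_common_root:
  fixes p q :: "complex poly"
  assumes "\<And>z. poly p z = 0 \<Longrightarrow> poly q z \<noteq> 0"
  shows "coprime p q"
proof (rule ccontr)
  assume "\<not> coprime p q"
  then obtain d where d: "d dvd p" "d dvd q" "\<not> is_unit d" by (auto simp: coprime_def)
  have "p \<noteq> 0 \<or> q \<noteq> 0" using assms[of 0] by auto
  hence "d \<noteq> 0" using d by auto
  hence "degree d \<noteq> 0" using d(3) by (simp add: is_unit_iff_degree)
  hence "degree d > 0" by simp
  hence "\<exists>z. poly d z = 0"
    using alg_closed_imp_poly_has_root[of d] by blast
  then obtain z where "poly d z = 0" by blast
  with d(1,2) assms[of z] show False by (auto elim!: dvdE)
qed

lemma lagrange_interpolation:
  fixes X :: "complex set"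
  assumes "finite X"
  shows "\<exists>p. degree p \<le> card X - 1 \<and> (\<forall>x\<in>X. poly p x = f x)"
  using assms
proof (induction X rule: finite_induct)
  case empty show ?case by (rule exI[of _ 0]) simp
next
  case (insert x X)
  then obtain p where p: "degree p \<le> card X - 1" "\<And>y. y \<in> X \<Longrightarrow> poly p y = f y" by blast
  define q where "q = (\<Prod>y\<in>X. [:-y, 1:])"
  define c where "c = (f x - poly p x) / poly q x"
  have q: "poly q x \<noteq> 0" "\<And>y. y \<in> X \<Longrightarrow> poly q y = 0" "degree q \<le> card X"
    using insert.hyps order_trans[OF degree_prod_sum_le, of X "\<lambda>y. [:-y, 1:]"]
    by (auto simp: q_def poly_prod)
  have "degree (p + smult c q) \<le> card X"
    using p(1) q(3) by (intro degree_add_le) (auto intro: order_trans[OF degree_smult_le])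
  moreover have "poly (p + smult c q) y = f y" if "y \<in> insert x X" for y
    using that p(2) q(1,2) by (auto simp: c_def)
  ultimately show ?case using insert.hyps by (intro exI[of _ "p + smult c q"]) simp
qed

text \<open>
  As \<open>C\<close> has no zero in the disc, its conjugate reciprocal \<open>C'\<close> has all its zeros inside, so the two
  are coprime. Solving \<open>u C' + p C = N\<close> and passing to \<open>e = u - p'\<close>, with \<open>p'\<close> the conjugate
  reciprocal of \<open>p\<close>, gives \<open>Im (e * cnj C) = Im (z^(-m) * N)\<close> on the circle, and \<open>N\<close> of degree at
  most \<open>2 m\<close> may take any values at \<open>2 m\<close> points.
\<close>

lemma Im_quotient_interpolation:
  fixes C :: "complex poly" and v :: "complex \<Rightarrow> real"
  assumes deg: "degree C \<le> m" and C: "\<And>z. z \<in> cball 0 1 \<Longrightarrow> poly C z \<noteq> 0"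
    and X: "finite X" "X \<subseteq> sphere 0 1" "card X \<le> 2 * m"
  shows "\<exists>e. degree e \<le> m \<and> (\<forall>z\<in>X. Im (poly e z / poly C z) = v z)"
proof -
  define C' where "C' = conj_reciprocal m C"
  have "coeff C' m \<noteq> 0"
    using C[of 0] by (simp add: C'_def coeff_conj_reciprocal_top poly_0_coeff_0)
  hence degC': "degree C' = m" and C'0: "C' \<noteq> 0"
    using degree_conj_reciprocal_le[of m C] le_degree[of C' m] by (auto simp: C'_def)
  have "coprime C C'"
  proof (rule coprime_if_no_common_root)
    fix z assume z: "poly C z = 0"
    hence "cmod z > 1" using C[of z] by fastforce
    hence "z \<noteq> 0" "inverse (cnj z) \<in> cball 0 1"
      by (auto simp: norm_inverse inverse_le_1_iff)
    thus "poly C' z \<noteq> 0"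
      using C[of "inverse (cnj z)"] by (simp add: C'_def poly_conj_reciprocal[OF deg])
  qed
  define x y where "x = fst (bezout_coefficients C C')" and "y = snd (bezout_coefficients C C')"
  have "x * C + y * C' = gcd C C'"
    unfolding x_def y_def by (rule bezout_coefficients_fst_snd)
  with \<open>coprime C C'\<close> have xy: "x * C + y * C' = 1"
    by (simp add: coprime_iff_gcd_eq_1)
  obtain N where N: "degree N \<le> card X - 1"
    "\<And>z. z \<in> X \<Longrightarrow> poly N z = z ^ m * (\<i> * of_real (v z * (cmod (poly C z))\<^sup>2))"
    using lagrange_interpolation[OF X(1), of "\<lambda>z. z ^ m * (\<i> * of_real (v z * (cmod (poly C z))\<^sup>2))"]
    by blast
  have degN: "degree N \<le> 2 * m" using N(1) X(3) by linarith
  \<comment> \<open>A Bezout solution \<open>(u, p)\<close> reduced modulo \<open>C'\<close>: since \<open>C'\<close> has degree exactly \<open>m\<close>, both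
      components end up with degree at most \<open>m\<close>.\<close>
  define p where "p = (x * N) mod C'"
  define q where "q = (x * N) div C'"
  define u where "u = y * N + q * C"
  have p: "p = x * N - q * C'" by (simp add: p_def q_def minus_div_mult_eq_mod)
  have sum: "u * C' + p * C = N"
  proof -
    have "u * C' + p * C = (x * C + y * C') * N" by (simp add: u_def p algebra_simps)
    thus ?thesis using xy by simp
  qed
  have degp: "degree p \<le> m"
    unfolding p_def using degree_mod_less[OF C'0, of "x * N"] degC' by auto
  have degu: "degree u \<le> m"
  proof (cases "u = 0")
    case False
    have "degree (p * C) \<le> 2 * m" using degp deg degree_mult_le[of p C] by linarith
    moreover have "u * C' = N - p * C" using sum by (simp add: algebra_simps)
    ultimately have "degree (u * C') \<le> 2 * m" using degN by (simp add: degree_diff_le)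
    thus ?thesis using False C'0 degC' by (simp add: degree_mult_eq)
  qed simp
  define e where "e = u - conj_reciprocal m p"
  have "degree e \<le> m"
    unfolding e_def using degu degree_conj_reciprocal_le by (intro degree_diff_le)
  moreover have "Im (poly e z / poly C z) = v z" if z: "z \<in> X" for z
  proof -
    have z1: "cmod z = 1" using z X(2) by auto
    hence Cz: "poly C z \<noteq> 0" and zz: "z * cnj z = 1"
      using C[of z] by (auto simp: complex_norm_square[symmetric])
    hence zm: "z ^ m * cnj z ^ m = 1" by (metis power_mult_distrib power_one)
    define U P c where "U = poly u z" and "P = poly p z" and "c = poly C z"
    have "U * (z ^ m * cnj c) + P * c = z ^ m * (\<i> * of_real (v z * (cmod c)\<^sup>2))"
      using N(2)[OF z] arg_cong[OF sum, of "\<lambda>q. poly q z"]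
      by (simp add: U_def P_def c_def C'_def poly_conj_reciprocal_sphere[OF deg z1])
    hence "cnj z ^ m * (U * (z ^ m * cnj c) + P * c) = cnj z ^ m * (z ^ m * (\<i> * of_real (v z * (cmod c)\<^sup>2)))"
      by simp
    hence "(z ^ m * cnj z ^ m) * U * cnj c + cnj z ^ m * P * c
        = (z ^ m * cnj z ^ m) * (\<i> * of_real (v z * (cmod c)\<^sup>2))"
      by (simp add: algebra_simps)
    hence eq: "U * cnj c + cnj z ^ m * P * c = \<i> * of_real (v z * (cmod c)\<^sup>2)"
      using zm by simp
    have "poly e z * cnj c = U * cnj c - cnj (cnj z ^ m * P * c)"
      by (simp add: e_def poly_conj_reciprocal_sphere[OF degp z1] U_def P_def algebra_simps)
    moreover have "Im (x - cnj y) = Im (x + y)" for x y by simp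
    ultimately have "Im (poly e z * cnj c) = Im (U * cnj c + cnj z ^ m * P * c)" by (simp only:)
    hence im: "Im (poly e z * cnj c) = v z * (cmod c)\<^sup>2" by (simp add: eq)
    have "poly e z / c = poly e z * cnj c / of_real ((cmod c)\<^sup>2)"
      using Cz by (simp only: complex_norm_square) (simp add: c_def)
    hence "Im (poly e z / c) = Im (poly e z * cnj c) / (cmod c)\<^sup>2"
      by (simp only: Im_divide_of_real)
    thus ?thesis using im Cz by (simp add: c_def)
  qed
  ultimately show ?thesis by blast
qed

section \<open>Zeros of a multiplier in the closed disc\<close>

text \<open>
  The factor \<open>r^k\<close> by which \<open>(z - a)^k\<close> shrinks along the ray \<open>z = a + r w\<close> is positive, so the
  leading coefficient inherits the sign as \<open>r\<close> tends to \<open>0\<close>.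
\<close>

lemma inward_direction_nonneg:
  assumes weak: "\<And>z. z \<in> cball 0 1 \<Longrightarrow> Re (poly ([:-a, 1:] ^ k * D) z * cnj (poly A z)) \<ge> 0"
    and inward: "\<forall>\<^sub>F r in at_right 0. a + of_real r * w \<in> cball 0 1"
  shows "Re (w ^ k * poly D a * cnj (poly A a)) \<ge> 0"
proof (rule tendsto_lowerbound)
  have lim: "((\<lambda>r. a + of_real r * w) \<longlongrightarrow> a) (at_right 0)"
    by (rule tendsto_eq_intros refl tendsto_ident_at | simp)+
  show "((\<lambda>r. Re (w ^ k * poly D (a + of_real r * w) * cnj (poly A (a + of_real r * w))))
      \<longlongrightarrow> Re (w ^ k * poly D a * cnj (poly A a))) (at_right 0)"
    by (intro tendsto_intros isCont_tendsto_compose[OF poly_isCont lim])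
  have "\<forall>\<^sub>F r in at_right (0::real). r > 0" by (rule eventually_at_right_less)
  with inward show "\<forall>\<^sub>F r in at_right 0.
      Re (w ^ k * poly D (a + of_real r * w) * cnj (poly A (a + of_real r * w))) \<ge> 0"
  proof eventually_elim
    case (elim r)
    have "poly ([:-a, 1:] ^ k * D) (a + of_real r * w) * cnj (poly A (a + of_real r * w))
       = of_real (r ^ k) * (w ^ k * poly D (a + of_real r * w) * cnj (poly A (a + of_real r * w)))"
      by (simp add: power_mult_distrib)
    with weak[OF elim(1)] have
      "0 \<le> r ^ k * Re (w ^ k * poly D (a + of_real r * w) * cnj (poly A (a + of_real r * w)))"
      by (metis Re_complex_of_real Im_complex_of_real times_complex.sel(1) mult_zero_left diff_zero)
    moreover have "0 \<le> x" if "0 \<le> c * x" "0 < c" for c x :: real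
      using that by (simp add: zero_le_mult_iff)
    ultimately show ?case using zero_less_power[OF elim(2), of k] by blast
  qed
qed auto

lemma inward_at_sphere:
  assumes a: "cmod a = 1" and v: "Re v > 0"
  shows "\<forall>\<^sub>F r in at_right 0. a + of_real r * (- a * v) \<in> cball 0 1"
proof -
  have vn: "(cmod v)\<^sup>2 > 0" using v by auto
  have "\<forall>\<^sub>F r in at_right (0::real). r > 0" by (rule eventually_at_right_less)
  moreover have "\<forall>\<^sub>F r in at_right 0. r < 2 * Re v / (cmod v)\<^sup>2"
    using v vn by (intro order_tendstoD(2)[OF tendsto_ident_at]) auto
  ultimately show ?thesis
  proof eventually_elim
    case (elim r)
    have "(cmod (1 - of_real r * v))\<^sup>2 = 1 - r * (2 * Re v - r * (cmod v)\<^sup>2)"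
      unfolding cmod_power2 by (simp add: power2_eq_square algebra_simps)
    moreover have "r * (2 * Re v - r * (cmod v)\<^sup>2) \<ge> 0"
      using elim vn by (simp add: pos_less_divide_eq)
    ultimately have "(cmod (1 - of_real r * v))\<^sup>2 \<le> 1\<^sup>2" by simp
    hence "cmod (1 - of_real r * v) \<le> 1" by (rule power2_le_imp_le) simp
    moreover have "a + of_real r * (- a * v) = a * (1 - of_real r * v)" by (simp add: algebra_simps)
    ultimately show ?case using a by (simp add: norm_mult)
  qed
qed

lemma nth_root_in_sector:
  assumes "w \<noteq> 0" "k \<noteq> 0"
  obtains v where "v ^ k = w" "k \<ge> 2 \<Longrightarrow> Re v \<ge> 0"
proof
  define v where "v = exp (Ln w / of_nat k)"
  show "v ^ k = w" using assms by (simp add: v_def exp_of_nat_mult[symmetric])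
  show "Re v \<ge> 0" if k: "k \<ge> 2"
  proof -
    have "\<bar>Im (Ln w)\<bar> \<le> pi"
      using Im_Ln_le_pi[OF assms(1)] mpi_less_Im_Ln[OF assms(1)] by linarith
    moreover have "pi \<le> pi * (real k / 2)" using k by simp
    ultimately have "\<bar>Im (Ln w)\<bar> \<le> pi * (real k / 2)" by linarith
    hence "Im (Ln w) / real k \<le> pi / 2" "- (pi / 2) \<le> Im (Ln w) / real k"
      using k by (simp_all add: field_simps abs_le_iff)
    hence "cos (Im (Ln w) / real k) \<ge> 0" by (intro cos_ge_zero)
    thus ?thesis by (simp add: v_def Re_exp)
  qed
qed

text \<open>
  Near a zero of order \<open>k\<close>, \<open>Re (C * cnj A)\<close> looks like \<open>Re (w^k * u)\<close> in the direction \<open>w\<close>. If all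
  directions are allowed, or if a half-plane of directions is allowed and \<open>k \<ge> 2\<close>, then \<open>w^k\<close> takes
  every argument and the real part becomes negative for some \<open>w\<close>. With \<open>k = 1\<close> and a half-plane of
  directions, the only possibility is that \<open>u\<close> is a positive multiple of \<open>- cnj a\<close>, the conjugate of
  the inward normal.
\<close>

lemma root_on_disc_is_simple_boundary_root:
  assumes weak: "\<And>z. z \<in> cball 0 1 \<Longrightarrow> Re (poly C z * cnj (poly A z)) \<ge> 0"
    and C: "C \<noteq> 0" "poly C a = 0" and a: "a \<in> cball 0 1" "poly A a \<noteq> 0"
    and D: "C = [:-a, 1:] * D"
  shows "cmod a = 1" "\<exists>\<kappa>>0. poly D a * cnj (poly A a) * a = - of_real \<kappa>"
proof -
  obtain E where E: "C = [:-a, 1:] ^ order a C * E" "\<not> [:-a, 1:] dvd E"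
    using order_decomp[OF C(1)] by blast
  define k where "k = order a C"
  have k: "k \<noteq> 0" using C order_root by (auto simp: k_def)
  define u where "u = poly E a * cnj (poly A a)"
  have "poly E a \<noteq> 0" using E(2) by (simp add: poly_eq_0_iff_dvd)
  hence u: "u \<noteq> 0" using a(2) by (simp add: u_def)
  have dir: "Re (w ^ k * u) \<ge> 0" if "\<forall>\<^sub>F r in at_right 0. a + of_real r * w \<in> cball 0 1" for w
    using inward_direction_nonneg[of a k E A w] weak E(1) that by (simp add: k_def u_def mult.assoc)
  have neg: "Re (- cnj x * x) < 0" if "x \<noteq> 0" for x :: complex
  proof -
    have "(Re x)\<^sup>2 + (Im x)\<^sup>2 > 0" using that by (simp add: complex_eq_iff sum_power2_gt_zero_iff)
    thus ?thesis by (simp add: power2_eq_square)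
  qed
  show a1: "cmod a = 1"
  proof (rule ccontr)
    assume "cmod a \<noteq> 1"
    hence ball: "a \<in> ball 0 1" using a(1) by simp
    obtain w where w: "w ^ k = - cnj u" using nth_root_in_sector[of "- cnj u" k] u k by auto
    have "((\<lambda>r. a + of_real r * w) \<longlongrightarrow> a) (at_right 0)"
      by (rule tendsto_eq_intros refl tendsto_ident_at | simp)+
    from topological_tendstoD[OF this open_ball ball]
    have "\<forall>\<^sub>F r in at_right 0. a + of_real r * w \<in> ball 0 1" .
    hence "\<forall>\<^sub>F r in at_right 0. a + of_real r * w \<in> cball 0 1"
      by (rule eventually_mono) auto
    from dir[OF this] neg[OF u] w show False by simp
  qed
  \<comment> \<open>At a boundary point the admissible directions are \<open>w = - a v\<close> with \<open>Re v > 0\<close>; the inequality persists for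
      \<open>Re v = 0\<close> by continuity, which is needed for \<open>k = 2\<close>.\<close>
  define u' where "u' = (- a) ^ k * u"
  have u': "u' \<noteq> 0" using u a1 by (auto simp: u'_def)
  have dir': "Re (v ^ k * u') \<ge> 0" if v: "Re v \<ge> 0" for v
  proof (rule tendsto_lowerbound)
    show "((\<lambda>d. Re ((v + of_real d) ^ k * u')) \<longlongrightarrow> Re (v ^ k * u')) (at_right 0)"
      by (rule tendsto_eq_intros refl tendsto_ident_at | simp)+
    have "\<forall>\<^sub>F d in at_right (0::real). d > 0" by (rule eventually_at_right_less)
    thus "\<forall>\<^sub>F d in at_right 0. Re ((v + of_real d) ^ k * u') \<ge> 0"
    proof eventually_elim
      case (elim d)
      hence "Re (v + of_real d) > 0" using v by simp
      from dir[OF inward_at_sphere[OF a1 this]] show ?case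
        by (simp add: u'_def power_mult_distrib[symmetric] algebra_simps)
    qed
  qed auto
  have k1: "k = 1"
  proof (rule ccontr)
    assume "k \<noteq> 1"
    obtain v where "v ^ k = - cnj u'" "k \<ge> 2 \<Longrightarrow> Re v \<ge> 0"
      using nth_root_in_sector[of "- cnj u'" k] u' k by auto
    with dir'[of v] neg[OF u'] \<open>k \<noteq> 1\<close> k show False by simp
  qed
  have "Im u' = 0" "Re u' \<ge> 0" using dir'[of \<i>] dir'[of "-\<i>"] dir'[of 1] k1 by auto
  moreover have "E = D" using E(1) D k1 unfolding k_def by (simp del: mult_pCons_left)
  ultimately show "\<exists>\<kappa>>0. poly D a * cnj (poly A a) * a = - of_real \<kappa>"
    using u' k1 by (intro exI[of _ "Re u'"]) (auto simp: u'_def u_def complex_eq_iff algebra_simps)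
qed

section \<open>Double zeros of nonnegative trigonometric polynomials\<close>

text \<open>
  On the circle this is \<open>z^n\<close> times the trigonometric polynomial \<open>2 Re (C * cnj A)\<close>.
\<close>

definition paired_real_part :: "nat \<Rightarrow> complex poly \<Rightarrow> complex poly \<Rightarrow> complex poly" where
  "paired_real_part n C A = C * conj_reciprocal n A + A * conj_reciprocal n C"

lemma degree_paired_real_part:
  assumes "degree C \<le> n" "degree A \<le> n"
  shows "degree (paired_real_part n C A) \<le> 2 * n"
proof -
  have "degree (C * conj_reciprocal n A) \<le> 2 * n" "degree (A * conj_reciprocal n C) \<le> 2 * n"
    using assms degree_conj_reciprocal_le[of n A] degree_conj_reciprocal_le[of n C]
      degree_mult_le[of C "conj_reciprocal n A"] degree_mult_le[of A "conj_reciprocal n C"] by linarith+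
  thus ?thesis unfolding paired_real_part_def by (rule degree_add_le)
qed

lemma poly_paired_real_part:
  assumes "degree C \<le> n" "degree A \<le> n" "cmod z = 1"
  shows "poly (paired_real_part n C A) z = z ^ n * of_real (2 * Re (poly C z * cnj (poly A z)))"
  using assms
  by (simp add: paired_real_part_def poly_conj_reciprocal_sphere complex_eq_iff algebra_simps)

text \<open>
  In the angular variable, \<open>f\<close> has a minimum at \<open>a\<close>, so its derivative vanishes, and the derivative of
  \<open>N\<close> along the circle with it.
\<close>

lemma double_root_of_nonneg_on_circle:
  assumes N: "\<And>z. cmod z = 1 \<Longrightarrow> poly N z = z ^ n * of_real (f z)"
    and f: "\<And>z. cmod z = 1 \<Longrightarrow> f z \<ge> 0"
    and a: "cmod a = 1" "f a = 0"
  shows "poly N a = 0" "poly (pderiv N) a = 0"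
proof -
  show Na: "poly N a = 0" using N[OF a(1)] a(2) by simp
  have ann: "a \<noteq> 0" using a by auto
  \<comment> \<open>The function \<open>f\<close> along the circle, extended to complex angles.\<close>
  define h where "h = (\<lambda>x. inverse a ^ n * exp (- (\<i> * of_nat n * x)) * poly N (a * exp (\<i> * x)))"
  define D where "D = inverse a ^ n * (poly (pderiv N) a * (a * \<i>))"
  have d1: "((\<lambda>x. poly N (a * exp (\<i> * x))) has_field_derivative poly (pderiv N) a * (a * \<i>)) (at 0)"
    by (rule DERIV_chain2[where f = "poly N"] poly_DERIV derivative_eq_intros refl | simp)+
  have d2: "((\<lambda>x. inverse a ^ n * exp (- (\<i> * of_nat n * x))) has_field_derivative
      - ((inverse a ^ n) * (\<i> * of_nat n))) (at 0)"
    by (rule derivative_eq_intros refl | simp)+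
  have "(h has_field_derivative D) (at 0)"
    unfolding h_def by (rule DERIV_cong[OF DERIV_mult[OF d2 d1]]) (simp add: D_def Na)
  hence "(h has_field_derivative D) (at (of_real 0))" by simp
  hence vd: "((\<lambda>t. h (of_real t)) has_vector_derivative D) (at 0)"
    by (rule has_vector_derivative_real_field)
  have h: "h (of_real t) = of_real (f (a * exp (\<i> * of_real t)))" for t
  proof -
    have "cmod (a * exp (\<i> * of_real t)) = 1" using a by (simp add: norm_mult)
    moreover from this have "a * exp (\<i> * of_real t) \<noteq> 0" by auto
    ultimately show ?thesis unfolding h_def
      by (simp add: N power_inverse power_mult_distrib exp_minus exp_of_nat_mult[symmetric] mult_ac)
  qed
  have dRe: "((\<lambda>t. f (a * exp (\<i> * of_real t))) has_field_derivative Re D) (at 0)"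
    using vd unfolding has_vector_derivative_complex_iff h by simp
  have dIm: "((\<lambda>t. 0) has_field_derivative Im D) (at (0::real))"
    using vd unfolding has_vector_derivative_complex_iff h by simp
  have "Re D = 0"
    using f a by (intro DERIV_local_min[OF dRe, of 1]) (auto simp: norm_mult)
  moreover have "Im D = 0" using DERIV_unique[OF dIm DERIV_const] by simp
  ultimately have "D = 0" by (simp add: complex_eq_iff)
  thus "poly (pderiv N) a = 0" using ann by (simp add: D_def)
qed

lemma card_double_roots_le:
  fixes N :: "complex poly"
  assumes N: "N \<noteq> 0" and Z: "\<And>z. z \<in> Z \<Longrightarrow> poly N z = 0 \<and> poly (pderiv N) z = 0"
  shows "finite Z" "2 * card Z \<le> degree N"
proof -
  have sub: "Z \<subseteq> {z. poly N z = 0}" using Z by auto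
  show fin: "finite Z" using finite_subset[OF sub poly_roots_finite[OF N]] .
  have ord: "2 \<le> order z N" if "z \<in> Z" for z
  proof -
    have "[:-z, 1:] dvd N" using Z[OF that] by (simp add: poly_eq_0_iff_dvd)
    then obtain M where M: "N = [:-z, 1:] * M" by (elim dvdE)
    have "poly M z = 0" using Z[OF that] 
      by (simp add: M pderiv_mult pderiv_pCons del: mult_pCons_left)
    hence "[:-z, 1:] ^ 2 dvd N" unfolding M power2_eq_square
      by (intro mult_dvd_mono) (auto simp: poly_eq_0_iff_dvd)
    thus ?thesis using N order_divides by blast
  qed
  have "2 * card Z = (\<Sum>z\<in>Z. 2)" by simp
  also have "\<dots> \<le> (\<Sum>z\<in>Z. order z N)" using ord by (intro sum_mono)
  also have "\<dots> \<le> (\<Sum>z\<in>{z. poly N z = 0}. order z N)"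
    using sub poly_roots_finite[OF N] by (intro sum_mono2) auto
  also have "\<dots> = size (proots N)" using N by (simp add: size_multiset_overloaded_eq)
  also have "\<dots> \<le> degree N" by (rule size_proots_le)
  finally show "2 * card Z \<le> degree N" .
qed

lemma prod_linear_factors_dvd:
  fixes C :: "complex poly"
  assumes "finite G" "\<And>z. z \<in> G \<Longrightarrow> poly C z = 0"
  shows "(\<Prod>z\<in>G. [:-z, 1:]) dvd C"
  using assms
proof (induction G rule: finite_induct)
  case (insert x G)
  then obtain E where E: "C = (\<Prod>z\<in>G. [:-z, 1:]) * E" by (auto elim: dvdE)
  have "poly (\<Prod>z\<in>G. [:-z, 1:]) x \<noteq> 0" using insert.hyps by (auto simp: poly_prod)
  moreover have "poly C x = 0" using insert.prems by simp
  ultimately have "poly E x = 0" by (simp add: E)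
  hence "[:-x, 1:] dvd E" by (simp add: poly_eq_0_iff_dvd)
  thus ?case using insert.hyps by (simp add: E mult.commute mult_dvd_mono del: mult_pCons_left mult_pCons_right)
qed simp

section \<open>From weak to strict positivity\<close>

text \<open>
  On the compact set where \<open>q \<le> 0\<close> the function \<open>p\<close> has a positive minimum; elsewhere nothing can go
  wrong.
\<close>

lemma add_small_multiple_pos_on_compact:
  fixes p q :: "'a::topological_space \<Rightarrow> real"
  assumes K: "compact K" and cont: "continuous_on K p" "continuous_on K q"
    and p: "\<And>x. x \<in> K \<Longrightarrow> p x \<ge> 0" and q: "\<And>x. x \<in> K \<Longrightarrow> p x = 0 \<Longrightarrow> q x > 0"
  shows "\<exists>e0>0. \<forall>e x. 0 < e \<and> e < e0 \<and> x \<in> K \<longrightarrow> p x + e * q x > 0"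
proof -
  define L where "L = {x \<in> K. q x \<le> 0}"
  have good: "p x + e * q x > 0" if "x \<in> K - L" "e > 0" for x e
    using that p[of x] by (auto simp: L_def intro!: add_nonneg_pos)
  show ?thesis
  proof (cases "L = {}")
    case True
    thus ?thesis using good by (intro exI[of _ 1]) auto
  next
    case False
    have "compact L"
    proof -
      have "closedin (top_of_set K) (K \<inter> q -` {..0})"
        by (rule continuous_closedin_preimage[OF cont(2) closed_atMost])
      moreover have "K \<inter> q -` {..0} = L" by (auto simp: L_def)
      ultimately show ?thesis using K by (auto intro: closedin_compact)
    qed
    moreover have "L \<subseteq> K" by (auto simp: L_def)
    ultimately obtain x0 x1 where x0: "x0 \<in> L" "\<And>x. x \<in> L \<Longrightarrow> p x0 \<le> p x"
      and x1: "x1 \<in> L" "\<And>x. x \<in> L \<Longrightarrow> q x1 \<le> q x"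
      using continuous_attains_inf[of L p] continuous_attains_inf[of L q] False
        continuous_on_subset[OF cont(1)] continuous_on_subset[OF cont(2)] by metis
    have "p x0 \<noteq> 0" using x0(1) q[of x0] by (auto simp: L_def)
    hence d: "p x0 > 0" using x0(1) p[of x0] by (auto simp: L_def)
    have M: "1 - q x1 > 0" using x1(1) by (auto simp: L_def)
    show ?thesis
    proof (intro exI[of _ "p x0 / (1 - q x1)"] conjI allI impI)
      show "p x0 / (1 - q x1) > 0" using d M by simp
      fix e x assume ex: "0 < e \<and> e < p x0 / (1 - q x1) \<and> x \<in> K"
      show "p x + e * q x > 0"
      proof (cases "x \<in> L")
        case True
        have "e - e * q x1 < p x0" using ex M by (simp add: pos_less_divide_eq right_diff_distrib)
        moreover have "e * q x1 \<le> e * q x" using ex x1(2)[OF True] by (intro mult_left_mono) auto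
        ultimately show ?thesis using x0(2)[OF True] ex by linarith
      qed (use good ex in auto)
    qed
  qed
qed

text \<open>
  If \<open>x * cnj y\<close> were real and not positive, then \<open>x\<close> and \<open>y\<close> would lie on opposite rays, and the
  segment between them would pass through \<open>0\<close>.
\<close>

lemma positive_ratio_if_segment_avoids_0:
  assumes seg: "\<And>t. t \<in> {0..1::real} \<Longrightarrow> of_real (1 - t) * x + of_real t * y \<noteq> 0"
    and im: "Im (x * cnj y) = 0"
  shows "Re (x * cnj y) > 0"
proof (rule ccontr)
  assume neg: "\<not> ?thesis"
  define r where "r = - Re (x * cnj y)"
  have r: "r \<ge> 0" using neg by (simp add: r_def)
  have y: "y \<noteq> 0" using seg[of 1] by auto
  define s where "s = (cmod y)\<^sup>2"
  have s: "s > 0" using y by (simp add: s_def)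
  have "x * cnj y = - of_real r" using im by (simp add: r_def complex_eq_iff)
  hence "(x * cnj y) * y = - of_real r * y" by simp
  hence "x * (y * cnj y) = - of_real r * y" by (simp only: mult_ac)
  hence xs: "x * of_real s = - of_real r * y" by (simp only: s_def complex_norm_square)
  define t where "t = r / (s + r)"
  have t: "t \<in> {0..1}" using r s by (auto simp: t_def divide_simps)
  have "1 - t = s / (s + r)" using r s by (simp add: t_def field_simps)
  hence "of_real (1 - t) * x + of_real t * y = (x * of_real s + of_real r * y) / of_real (s + r)"
    by (simp add: t_def add_divide_distrib mult.commute)
  thus False using seg[OF t] xs by simp
qed

text \<open>
  Knowing two numbers relative to a common \<open>c\<close> means knowing them relative to each other: this is how
  information about \<open>C * cnj A\<close> and \<open>C * cnj B\<close> turns into information about \<open>A * cnj B\<close>.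
\<close>

lemma mult_cnj_via_common_factor:
  fixes c x y :: complex
  shows "cnj (c * cnj x) * (c * cnj y) = of_real ((cmod c)\<^sup>2) * (x * cnj y)"
  by (simp only: complex_norm_square) simp

text \<open>
  The heart of the proof. The perturbation is \<open>C + \<epsilon> E\<close>, where \<open>E\<close> must point in the right direction
  at the zeros of \<open>P = Re (C * cnj A)\<close> and \<open>Q = Re (C * cnj B)\<close>. In general \<open>E = A + g e\<close>, where \<open>g\<close>
  collects the zeros of \<open>C\<close> on the circle: at these \<open>E = A\<close>, which is right for \<open>A\<close> and also for \<open>B\<close>,
  since \<open>A\<close> and \<open>B\<close> are positive multiples of each other there; at the remaining points \<open>e\<close> is
  found by interpolation.
\<close>

lemma strict_perturbation:
  fixes A B C :: "complex poly"
  assumes deg: "degree A \<le> n" "degree B \<le> n" "degree C \<le> n"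
    and seg: "\<And>t z. t \<in> {0..1::real} \<Longrightarrow> z \<in> cball 0 1 \<Longrightarrow> of_real (1 - t) * poly A z + of_real t * poly B z \<noteq> 0"
    and C: "C \<noteq> 0"
    and weakA: "\<And>z. z \<in> sphere 0 1 \<Longrightarrow> Re (poly C z * cnj (poly A z)) \<ge> 0"
    and weakB: "\<And>z. z \<in> sphere 0 1 \<Longrightarrow> Re (poly C z * cnj (poly B z)) \<ge> 0"
  shows "\<exists>E. degree E \<le> n \<and> (\<forall>z\<in>sphere 0 1.
           Re (poly E z * cnj (poly A z)) > 0 \<and> Re (poly E z * cnj (poly B z)) > 0)"
proof -
  define P where "P = (\<lambda>z. Re (poly C z * cnj (poly A z)))"
  define Q where "Q = (\<lambda>z. Re (poly C z * cnj (poly B z)))"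
  have A0: "poly A z \<noteq> 0" and B0: "poly B z \<noteq> 0" if "z \<in> cball 0 1" for z
    using seg[of 0 z] seg[of 1 z] that by auto
  have self: "Re (x * cnj x) > 0" if "x \<noteq> 0" for x :: complex
  proof -
    have "x * cnj x = of_real ((cmod x)\<^sup>2)" by (simp only: complex_norm_square)
    thus ?thesis using that by (simp only: Re_complex_of_real) simp
  qed
  have par: "Re (poly A z * cnj (poly B z)) > 0"
    if "z \<in> cball 0 1" "Im (poly A z * cnj (poly B z)) = 0" for z
    using positive_ratio_if_segment_avoids_0[OF seg[OF _ that(1)] that(2)] by simp
  have wA: "Re (poly C z * cnj (poly A z)) \<ge> 0" if "z \<in> cball 0 1" for z
    by (rule Re_mult_cnj_nonneg_on_disc[OF A0 weakA that]) auto
  have wB: "Re (poly C z * cnj (poly B z)) \<ge> 0" if "z \<in> cball 0 1" for z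
    by (rule Re_mult_cnj_nonneg_on_disc[OF B0 weakB that]) auto
  \<comment> \<open>At a zero of \<open>C\<close>, \<open>D * cnj A\<close> and \<open>D * cnj B\<close> are both positive multiples of \<open>- cnj z\<close>, so \<open>A\<close> and \<open>B\<close> are
      parallel.\<close>
  have root: "cmod z = 1" "poly D z \<noteq> 0" "Re (poly A z * cnj (poly B z)) > 0"
    if z: "z \<in> cball 0 1" and D: "C = [:-z, 1:] * D" for z D
  proof -
    have C0: "poly C z = 0" by (simp add: D)
    show z1: "cmod z = 1" by (rule root_on_disc_is_simple_boundary_root(1)[OF wA C C0 z A0[OF z] D])
    obtain \<kappa> where \<kappa>: "\<kappa> > 0" "poly D z * cnj (poly A z) * z = - of_real \<kappa>"
      using root_on_disc_is_simple_boundary_root(2)[OF wA C C0 z A0[OF z] D] by auto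
    obtain \<mu> where \<mu>: "\<mu> > 0" "poly D z * cnj (poly B z) * z = - of_real \<mu>"
      using root_on_disc_is_simple_boundary_root(2)[OF wB C C0 z B0[OF z] D] by auto
    show "poly D z \<noteq> 0" using \<kappa> by auto
    have "cnj (z * poly D z * cnj (poly A z)) * (z * poly D z * cnj (poly B z)) = of_real (\<kappa> * \<mu>)"
      using \<kappa>(2) \<mu>(2) by (simp only: mult_ac) simp
    hence "of_real ((cmod (z * poly D z))\<^sup>2) * (poly A z * cnj (poly B z)) = of_real (\<kappa> * \<mu>)"
      by (simp only: mult_cnj_via_common_factor)
    hence "(cmod (z * poly D z))\<^sup>2 * Im (poly A z * cnj (poly B z)) = 0"
      by (metis Im_complex_of_real Re_complex_of_real add.right_neutral mult_zero_left times_complex.sel(2))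
    hence "Im (poly A z * cnj (poly B z)) = 0" using z1 \<open>poly D z \<noteq> 0\<close> by auto
    thus "Re (poly A z * cnj (poly B z)) > 0" by (rule par[OF z])
  qed
  \<comment> \<open>Where both real parts vanish, \<open>A\<close> and \<open>B\<close> are parallel, hence positive multiples of each other.\<close>
  have common: "Re (poly A z * cnj (poly B z)) > 0"
    "poly C z \<noteq> 0 \<Longrightarrow> Im (poly C z * cnj (poly A z)) * Im (poly C z * cnj (poly B z)) > 0"
    if z: "z \<in> sphere 0 1" and PQ: "P z = 0" "Q z = 0" for z
  proof -
    have zc: "z \<in> cball 0 1" using z by simp
    define y1 y2 where "y1 = Im (poly C z * cnj (poly A z))" and "y2 = Im (poly C z * cnj (poly B z))"
    have "poly C z * cnj (poly A z) = \<i> * of_real y1" "poly C z * cnj (poly B z) = \<i> * of_real y2"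
      using PQ by (simp_all add: P_def Q_def y1_def y2_def complex_eq_iff)
    hence "cnj (poly C z * cnj (poly A z)) * (poly C z * cnj (poly B z)) = of_real (y1 * y2)"
      by (simp only:) (simp add: complex_eq_iff)
    hence eq: "of_real ((cmod (poly C z))\<^sup>2) * (poly A z * cnj (poly B z)) = of_real (y1 * y2)"
      by (simp only: mult_cnj_via_common_factor)
    have im: "(cmod (poly C z))\<^sup>2 * Im (poly A z * cnj (poly B z)) = 0"
      using arg_cong[OF eq, of Im] by (simp only: times_complex.sel Im_complex_of_real Re_complex_of_real)
    have re: "(cmod (poly C z))\<^sup>2 * Re (poly A z * cnj (poly B z)) = y1 * y2"
      using arg_cong[OF eq, of Re] by (simp only: times_complex.sel Im_complex_of_real Re_complex_of_real)
    show pos: "Re (poly A z * cnj (poly B z)) > 0"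
    proof (cases "poly C z = 0")
      case True
      then obtain D where "C = [:-z, 1:] * D" by (auto simp: poly_eq_0_iff_dvd elim!: dvdE)
      thus ?thesis using root(3)[OF zc] by blast
    next
      case False
      with im have "Im (poly A z * cnj (poly B z)) = 0" by (simp only: mult_eq_0_iff power_eq_0_iff norm_eq_zero) simp
      thus ?thesis by (rule par[OF zc])
    qed
    show "Im (poly C z * cnj (poly A z)) * Im (poly C z * cnj (poly B z)) > 0" if "poly C z \<noteq> 0"
      unfolding y1_def[symmetric] y2_def[symmetric] re[symmetric]
      using that by (intro mult_pos_pos pos) simp
  qed
  have "\<exists>E. degree E \<le> n \<and> (\<forall>z\<in>sphere 0 1.
      (P z = 0 \<longrightarrow> Re (poly E z * cnj (poly A z)) > 0) \<and> (Q z = 0 \<longrightarrow> Re (poly E z * cnj (poly B z)) > 0))"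
  \<comment> \<open>If \<open>P\<close> vanishes identically, zeros cannot be counted; but then every zero of \<open>Q\<close> is a common zero,
      and \<open>E = A\<close> is right everywhere. The case of \<open>Q\<close> is symmetric.\<close>
  proof (cases "(\<forall>z\<in>sphere 0 1. P z = 0) \<or> (\<forall>z\<in>sphere 0 1. Q z = 0)")
    case True
    thus ?thesis
    proof
      assume "\<forall>z\<in>sphere 0 1. P z = 0"
      thus ?thesis using common(1) self A0 deg(1) by (intro exI[of _ A]) auto
    next
      assume Qz: "\<forall>z\<in>sphere 0 1. Q z = 0"
      have "Re (x * cnj y) = Re (y * cnj x)" for x y :: complex by simp
      hence "\<forall>z\<in>sphere 0 1. P z = 0 \<longrightarrow> Re (poly B z * cnj (poly A z)) > 0"
        using common(1) Qz by metis
      thus ?thesis using self B0 deg(2) by (intro exI[of _ B]) auto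
    qed
  next
    case False
    define ZP where "ZP = {z \<in> sphere 0 1. P z = 0}"
    define ZQ where "ZQ = {z \<in> sphere 0 1. Q z = 0}"
    \<comment> \<open>The zeros are double roots of a nonzero polynomial of degree at most \<open>2 n\<close>.\<close>
    have few: "finite {z \<in> sphere 0 1. Re (poly C z * cnj (poly F z)) = 0}"
      "card {z \<in> sphere 0 1. Re (poly C z * cnj (poly F z)) = 0} \<le> n"
      if F: "degree F \<le> n" "\<exists>z\<in>sphere 0 1. Re (poly C z * cnj (poly F z)) \<noteq> 0"
        "\<And>z. z \<in> sphere 0 1 \<Longrightarrow> Re (poly C z * cnj (poly F z)) \<ge> 0" for F
    proof -
      define N where "N = paired_real_part n C F"
      have N: "poly N z = z ^ n * of_real (2 * Re (poly C z * cnj (poly F z)))" if "cmod z = 1" for z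
        unfolding N_def by (rule poly_paired_real_part[OF deg(3) F(1) that])
      obtain z where "z \<in> sphere 0 1" "Re (poly C z * cnj (poly F z)) \<noteq> 0" using F(2) by blast
      hence "poly N z \<noteq> 0" using N[of z] by (auto simp del: times_complex.sel)
      hence "N \<noteq> 0" by auto
      have dbl: "poly N z = 0 \<and> poly (pderiv N) z = 0"
        if "z \<in> {z \<in> sphere 0 1. Re (poly C z * cnj (poly F z)) = 0}" for z
        using double_root_of_nonneg_on_circle[OF N, of z] F(3) that by (simp del: times_complex.sel)
      show "finite {z \<in> sphere 0 1. Re (poly C z * cnj (poly F z)) = 0}"
        by (rule card_double_roots_le(1)[OF \<open>N \<noteq> 0\<close> dbl])
      show "card {z \<in> sphere 0 1. Re (poly C z * cnj (poly F z)) = 0} \<le> n"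
        using card_double_roots_le(2)[OF \<open>N \<noteq> 0\<close>, of "{z \<in> sphere 0 1. Re (poly C z * cnj (poly F z)) = 0}"]
          dbl degree_paired_real_part[OF deg(3) F(1)]
        unfolding N_def by (meson le_trans mult_le_cancel1 zero_less_numeral)
    qed
    have ZP: "finite ZP" "card ZP \<le> n" and ZQ: "finite ZQ" "card ZQ \<le> n"
      unfolding ZP_def ZQ_def P_def Q_def
      using few[OF deg(1) _ weakA] few[OF deg(2) _ weakB] False unfolding P_def Q_def by blast+
    define G where "G = {z \<in> sphere 0 1. poly C z = 0}"
    have G: "G \<subseteq> ZP" "G \<subseteq> ZQ" by (auto simp: G_def ZP_def ZQ_def P_def Q_def)
    have finG: "finite G" using finite_subset[OF G(1) ZP(1)] .
    define g where "g = (\<Prod>z\<in>G. [:-z, 1:])"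
    have degg: "degree g = card G" unfolding g_def by (subst degree_prod_eq_sum_degree) auto
    have "g dvd C" unfolding g_def by (rule prod_linear_factors_dvd) (use finG in \<open>auto simp: G_def\<close>)
    then obtain C1 where C1: "C = g * C1" by (elim dvdE)
    have "g \<noteq> 0" "C1 \<noteq> 0" using C C1 by auto
    define m where "m = n - card G"
    have mG: "card G + degree C1 \<le> n"
      using deg(3) \<open>g \<noteq> 0\<close> \<open>C1 \<noteq> 0\<close> degg by (simp add: C1 degree_mult_eq)
    hence degC1: "degree C1 \<le> m" by (simp add: m_def)
    have C1ne: "poly C1 z \<noteq> 0" if z: "z \<in> cball 0 1" for z
    proof
      assume "poly C1 z = 0"
      hence "[:-z, 1:] dvd C" by (simp add: C1 poly_eq_0_iff_dvd[symmetric])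
      then obtain D where D: "C = [:-z, 1:] * D" by (elim dvdE)
      have "z \<in> G" using root(1)[OF z D] by (simp add: G_def D)
      hence "g = [:-z, 1:] * (\<Prod>w\<in>G - {z}. [:-w, 1:])"
        unfolding g_def using finG by (rule prod.remove[rotated])
      hence "C = [:-z, 1:] * ((\<Prod>w\<in>G - {z}. [:-w, 1:]) * C1)" by (simp only: C1 mult.assoc)
      from root(2)[OF z this] \<open>poly C1 z = 0\<close> show False by simp
    qed
    define X where "X = (ZP - G) \<union> (ZQ - G)"
    have X: "finite X" "X \<subseteq> sphere 0 1" using ZP ZQ by (auto simp: X_def ZP_def ZQ_def)
    have "card X \<le> card (ZP - G) + card (ZQ - G)" unfolding X_def by (rule card_Un_le)
    also have "\<dots> \<le> 2 * m"
      using finG G ZP ZQ by (simp add: card_Diff_subset m_def)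
    finally have cardX: "card X \<le> 2 * m" .
    \<comment> \<open>If \<open>C * cnj A = \<i> y\<close>, then \<open>Re (E * cnj A) = - y * Im (E / C)\<close>; the choice \<open>Im (E / C) = - y\<close> makes this
        a square. At common zeros the value of \<open>y\<close> for \<open>B\<close> has the same sign.\<close>
    define y where "y z = (if P z = 0 then Im (poly C z * cnj (poly A z)) else Im (poly C z * cnj (poly B z)))" for z
    obtain e where e: "degree e \<le> m"
      "\<And>z. z \<in> X \<Longrightarrow> Im (poly e z / poly C1 z) = - y z - Im (poly A z / poly C z)"
      using Im_quotient_interpolation[OF degC1 C1ne X cardX, of "\<lambda>z. - y z - Im (poly A z / poly C z)"]
      by blast
    define E where "E = A + g * e"
    have "degree (g * e) \<le> n"
      using degree_mult_le[of g e] degg e(1) mG unfolding m_def by linarith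
    hence degE: "degree E \<le> n" unfolding E_def using deg(1) by (intro degree_add_le)
    have good: "(P z = 0 \<longrightarrow> Re (poly E z * cnj (poly A z)) > 0) \<and> (Q z = 0 \<longrightarrow> Re (poly E z * cnj (poly B z)) > 0)"
      if z: "z \<in> sphere 0 1" for z
    proof (cases "z \<in> G")
      case True
      hence "poly g z = 0" using finG by (auto simp: g_def poly_prod)
      hence "poly E z = poly A z" by (simp add: E_def)
      moreover have "P z = 0" "Q z = 0" using True by (auto simp: G_def P_def Q_def)
      ultimately show ?thesis using common(1)[OF z] self[OF A0] z by simp
    next
      case zG: False
      hence Cz: "poly C z \<noteq> 0" using z by (simp add: G_def)
      hence gz: "poly g z \<noteq> 0" by (auto simp: C1)
      have quot: "Im (poly E z / poly C z) = - y z" if "z \<in> X"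
      proof -
        have "poly E z / poly C z = poly A z / poly C z + poly e z / poly C1 z"
          using gz by (simp add: E_def C1 add_divide_distrib)
        thus ?thesis using e(2)[OF that] by simp
      qed
      have val: "Re (poly E z * cnj x) = y z * Im (poly C z * cnj x)"
        if "z \<in> X" "Re (poly C z * cnj x) = 0" for x
      proof -
        have "poly E z * cnj x = (poly E z / poly C z) * (poly C z * cnj x)" using Cz by simp
        also have "poly C z * cnj x = \<i> * of_real (Im (poly C z * cnj x))"
          using that(2) by (simp add: complex_eq_iff)
        finally have "poly E z * cnj x = (poly E z / poly C z) * (\<i> * of_real (Im (poly C z * cnj x)))" .
        moreover have "Re (w * (\<i> * of_real t)) = - Im w * t" for w t by simp
        ultimately have "Re (poly E z * cnj x) = - Im (poly E z / poly C z) * Im (poly C z * cnj x)"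
          by (simp only:)
        thus ?thesis using quot[OF that(1)] by simp
      qed
      have nz: "Im (poly C z * cnj x) \<noteq> 0" if "x \<noteq> 0" "Re (poly C z * cnj x) = 0" for x
        using that Cz by (metis complex_cnj_zero_iff complex_eq_iff mult_eq_0_iff zero_complex.sel)
      have zc: "z \<in> cball 0 1" using z by simp
      show ?thesis
      proof (intro conjI impI)
        assume Pz: "P z = 0"
        hence "z \<in> X" using z zG by (simp add: X_def ZP_def)
        hence "Re (poly E z * cnj (poly A z)) = y z * Im (poly C z * cnj (poly A z))"
          using val Pz unfolding P_def by blast
        also have "y z = Im (poly C z * cnj (poly A z))" unfolding y_def using Pz by (rule if_P)
        finally show "Re (poly E z * cnj (poly A z)) > 0"
          using nz[OF A0[OF zc]] Pz unfolding P_def by (metis not_real_square_gt_zero)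
      next
        assume Qz: "Q z = 0"
        hence "z \<in> X" using z zG by (simp add: X_def ZQ_def)
        hence "Re (poly E z * cnj (poly B z)) = y z * Im (poly C z * cnj (poly B z))"
          using val Qz unfolding Q_def by blast
        also have "\<dots> > 0"
        proof (cases "P z = 0")
          case True
          show ?thesis unfolding y_def if_P[OF True] by (rule common(2)[OF z True Qz Cz])
        next
          case False
          hence "y z = Im (poly C z * cnj (poly B z))" unfolding y_def by (rule if_not_P)
          thus ?thesis
            using nz[OF B0[OF zc]] Qz unfolding Q_def by (metis not_real_square_gt_zero)
        qed
        finally show "Re (poly E z * cnj (poly B z)) > 0" .
      qed
    qed
    show ?thesis using degE good by blast
  qed
  then obtain E where E: "degree E \<le> n"
    "\<And>z. z \<in> sphere 0 1 \<Longrightarrow> P z = 0 \<Longrightarrow> Re (poly E z * cnj (poly A z)) > 0"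
    "\<And>z. z \<in> sphere 0 1 \<Longrightarrow> Q z = 0 \<Longrightarrow> Re (poly E z * cnj (poly B z)) > 0" by blast
  have "\<exists>e0>0. \<forall>e z. 0 < e \<and> e < e0 \<and> z \<in> sphere 0 1 \<longrightarrow> P z + e * Re (poly E z * cnj (poly A z)) > 0"
    using E(2) weakA unfolding P_def
    by (intro add_small_multiple_pos_on_compact continuous_intros) (auto simp del: times_complex.sel)
  then obtain e1 where e1: "e1 > 0"
    "\<And>e z. 0 < e \<Longrightarrow> e < e1 \<Longrightarrow> z \<in> sphere 0 1 \<Longrightarrow> P z + e * Re (poly E z * cnj (poly A z)) > 0" by blast
  have "\<exists>e0>0. \<forall>e z. 0 < e \<and> e < e0 \<and> z \<in> sphere 0 1 \<longrightarrow> Q z + e * Re (poly E z * cnj (poly B z)) > 0"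
    using E(3) weakB unfolding Q_def
    by (intro add_small_multiple_pos_on_compact continuous_intros) (auto simp del: times_complex.sel)
  then obtain e2 where e2: "e2 > 0"
    "\<And>e z. 0 < e \<Longrightarrow> e < e2 \<Longrightarrow> z \<in> sphere 0 1 \<Longrightarrow> Q z + e * Re (poly E z * cnj (poly B z)) > 0" by blast
  define \<epsilon> where "\<epsilon> = min e1 e2 / 2"
  have \<epsilon>: "0 < \<epsilon>" "\<epsilon> < e1" "\<epsilon> < e2" using e1(1) e2(1) by (auto simp: \<epsilon>_def)
  have split: "Re (poly (C + smult (of_real \<epsilon>) E) z * cnj w) = Re (poly C z * cnj w) + \<epsilon> * Re (poly E z * cnj w)" for z w
    by (simp add: algebra_simps)
  have "degree (C + smult (of_real \<epsilon>) E) \<le> n"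
    using deg(3) E(1) degree_smult_le[of "of_real \<epsilon>" E] by (intro degree_add_le) linarith+
  moreover have "Re (poly (C + smult (of_real \<epsilon>) E) z * cnj (poly A z)) > 0"
    "Re (poly (C + smult (of_real \<epsilon>) E) z * cnj (poly B z)) > 0" if "z \<in> sphere 0 1" for z
    using e1(2)[OF \<epsilon>(1,2) that] e2(2)[OF \<epsilon>(1,3) that] unfolding split P_def Q_def .
  ultimately show ?thesis by blast
qed

section \<open>Deformation along the segment\<close>

lemma common_convergent_subsequence:
  fixes f :: "nat \<Rightarrow> nat \<Rightarrow> complex"
  assumes "\<And>k i. cmod (f k i) \<le> M"
  shows "\<exists>r l. strict_mono r \<and> (\<forall>i<m. (\<lambda>k. f (r k) i) \<longlonglongrightarrow> l i)"
proof (induction m)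
  case 0
  show ?case using strict_mono_id by blast
next
  case (Suc m)
  then obtain r l where r: "strict_mono r" "\<And>i. i < m \<Longrightarrow> (\<lambda>k. f (r k) i) \<longlonglongrightarrow> l i" by blast
  have "bounded (range (\<lambda>k. f (r k) m))" using assms by (auto simp: bounded_iff)
  then obtain x r' where r': "strict_mono r'" "((\<lambda>k. f (r k) m) \<circ> r') \<longlonglongrightarrow> x"
    using bounded_imp_convergent_subsequence by blast
  have "(\<lambda>k. f ((r \<circ> r') k) i) \<longlonglongrightarrow> (l(m := x)) i" if "i < Suc m" for i
  proof (cases "i = m")
    case True
    thus ?thesis using r'(2) by (simp add: o_def)
  next
    case False
    hence "(\<lambda>k. f (r k) i) \<longlonglongrightarrow> l i" using r(2) that by simp
    from LIMSEQ_subseq_LIMSEQ[OF this r'(1)] show ?thesis using False by (simp add: o_def)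
  qed
  thus ?case using strict_mono_o[OF r(1) r'(1)] by blast
qed

text \<open>
  Bolzano-Weierstrass in the finite-dimensional space of polynomials of degree at most \<open>n\<close>: the sum of
  the moduli of the coefficients is scaled to \<open>1\<close>, which keeps the limit away from \<open>0\<close>.
\<close>

lemma normalized_polys_convergent_subsequence:
  fixes C :: "nat \<Rightarrow> complex poly"
  assumes deg: "\<And>k. degree (C k) \<le> n" and ne: "\<And>k. C k \<noteq> 0"
  shows "\<exists>r c D. strict_mono r \<and> (\<forall>k. c k > (0::real)) \<and> D \<noteq> 0 \<and> degree D \<le> n \<and>
           (\<forall>z. (\<lambda>k. of_real (c k) * poly (C (r k)) z) \<longlonglongrightarrow> poly D z)"
proof -
  define N where "N k = (\<Sum>i\<le>n. cmod (coeff (C k) i))" for k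
  have N: "N k > 0" for k
  proof -
    have "coeff (C k) (degree (C k)) \<noteq> 0" using ne by simp
    moreover have "degree (C k) \<in> {..n}" using deg by simp
    ultimately show ?thesis unfolding N_def by (intro sum_pos2) auto
  qed
  define f where "f k i = (if i \<le> n then coeff (C k) i / of_real (N k) else 0)" for k i
  have sum1: "(\<Sum>i\<le>n. cmod (f k i)) = 1" for k
  proof -
    have "(\<Sum>i\<le>n. cmod (f k i)) = (\<Sum>i\<le>n. cmod (coeff (C k) i) / N k)"
      using N[of k] by (intro sum.cong) (auto simp: f_def norm_divide)
    also have "\<dots> = 1" using N[of k] by (simp add: sum_divide_distrib[symmetric] N_def)
    finally show ?thesis .
  qed
  have "cmod (f k i) \<le> 1" for k i
  proof (cases "i \<le> n")
    case True
    hence "cmod (f k i) \<le> (\<Sum>i\<le>n. cmod (f k i))" by (intro member_le_sum) auto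
    thus ?thesis by (simp add: sum1)
  qed (simp add: f_def)
  then obtain r l where r: "strict_mono r" "\<And>i. i < Suc n \<Longrightarrow> (\<lambda>k. f (r k) i) \<longlonglongrightarrow> l i"
    using common_convergent_subsequence[of f 1 "Suc n"] by blast
  define D where "D = (\<Sum>i\<le>n. monom (l i) i)"
  have "degree D \<le> n"
    unfolding D_def by (intro degree_sum_le) (auto intro: order_trans[OF degree_monom_le])
  moreover have "D \<noteq> 0"
  proof
    assume "D = 0"
    moreover have "coeff D i = (if i \<le> n then l i else 0)" for i by (simp add: D_def coeff_sum)
    ultimately have l0: "l i = 0" if "i \<le> n" for i using that by (metis coeff_0)
    have "(\<lambda>k. \<Sum>i\<le>n. cmod (f (r k) i)) \<longlonglongrightarrow> (\<Sum>i\<le>n. cmod (l i))"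
      using r(2) by (intro tendsto_intros) auto
    hence "(\<Sum>i\<le>n. cmod (l i)) = 1" by (simp add: sum1 LIMSEQ_const_iff)
    thus False using l0 by simp
  qed
  moreover have "(\<lambda>k. of_real (1 / N (r k)) * poly (C (r k)) z) \<longlonglongrightarrow> poly D z" for z
  proof -
    have "(\<lambda>k. \<Sum>i\<le>n. f (r k) i * z ^ i) \<longlonglongrightarrow> (\<Sum>i\<le>n. l i * z ^ i)"
      using r(2) by (intro tendsto_intros) auto
    moreover have "(\<Sum>i\<le>n. f (r k) i * z ^ i) = of_real (1 / N (r k)) * poly (C (r k)) z" for k
    proof -
      have "(\<Sum>i\<le>n. f (r k) i * z ^ i) = (\<Sum>i\<le>n. of_real (1 / N (r k)) * (coeff (C (r k)) i * z ^ i))"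
        by (intro sum.cong) (auto simp: f_def)
      thus ?thesis by (simp only: sum_distrib_left[symmetric] poly_as_sum_atMost[OF deg])
    qed
    moreover have "poly D z = (\<Sum>i\<le>n. l i * z ^ i)" by (simp add: D_def poly_sum poly_monom)
    ultimately show ?thesis by simp
  qed
  ultimately show ?thesis using r(1) N by (intro exI[of _ r] exI[of _ "\<lambda>k. 1 / N (r k)"] exI[of _ D]) auto
qed

text \<open>
  Continuity method: the supremum \<open>s\<close> of the parameters \<open>t\<close> that admit a multiplier for \<open>A\<close> and
  \<open>F t\<close> is attained by \<open>strict_perturbation\<close>, and it cannot lie below \<open>1\<close> since a strict multiplier
  tolerates a small increase of the parameter.
\<close>

lemma common_multiplier_on_circle:
  fixes A B :: "complex poly"
  assumes deg: "degree A \<le> n" "degree B \<le> n"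
    and seg: "\<And>t z. t \<in> {0..1::real} \<Longrightarrow> z \<in> cball 0 1 \<Longrightarrow> of_real (1 - t) * poly A z + of_real t * poly B z \<noteq> 0"
  shows "\<exists>C. degree C \<le> n \<and> (\<forall>z\<in>sphere 0 1.
           Re (poly C z * cnj (poly A z)) > 0 \<and> Re (poly C z * cnj (poly B z)) > 0)"
proof -
  define F where "F t = smult (of_real (1 - t)) A + smult (of_real t) B" for t :: real
  define ok where "ok t C \<longleftrightarrow> degree C \<le> n \<and> (\<forall>z\<in>sphere 0 1.
      Re (poly C z * cnj (poly A z)) > 0 \<and> Re (poly C z * cnj (poly (F t) z)) > 0)" for t C
  define S where "S = {t \<in> {0..1}. \<exists>C. ok t C}"
  have degF: "degree (F t) \<le> n" for t
    unfolding F_def using deg degree_smult_le order_trans by (intro degree_add_le) blast+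
  have F0: "F 0 = A" and F1: "F 1 = B" by (simp_all add: F_def)
  have A0: "poly A z \<noteq> 0" if "z \<in> cball 0 1" for z using seg[of 0 z] that by simp
  have self: "Re (x * cnj x) > 0" if "x \<noteq> 0" for x :: complex
    using that by (simp add: complex_eq_iff sum_power2_gt_zero_iff power2_eq_square[symmetric])
  have "ok 0 A" unfolding ok_def F0 using deg(1) self A0 by simp
  hence "0 \<in> S" by (auto simp: S_def)
  have bdd: "bdd_above S" by (rule bdd_aboveI[of _ 1]) (auto simp: S_def)
  define s where "s = Sup S"
  have s: "s \<in> {0..1}"
  proof -
    have "0 \<le> s" unfolding s_def by (rule cSup_upper[OF \<open>0 \<in> S\<close> bdd])
    moreover have "s \<le> 1" unfolding s_def
    proof (rule cSup_least)
      show "S \<noteq> {}" using \<open>0 \<in> S\<close> by blast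
    qed (simp add: S_def)
    ultimately show ?thesis by simp
  qed
  have "s \<in> closure S" unfolding s_def using \<open>0 \<in> S\<close> bdd by (intro closure_contains_Sup) auto
  then obtain t where t: "\<And>k. t k \<in> S" "t \<longlonglongrightarrow> s" unfolding closure_sequential by blast
  have "\<forall>k. \<exists>C. ok (t k) C" using t(1) by (auto simp: S_def)
  then obtain Ck where Ck: "\<And>k. ok (t k) (Ck k)" by metis
  have "degree (Ck k) \<le> n" "Ck k \<noteq> 0" for k
    using Ck[of k] unfolding ok_def by (auto dest: bspec[of _ _ 1])
  then obtain r c D where r: "strict_mono r" "\<And>k. c k > (0::real)" "D \<noteq> 0" "degree D \<le> n"
    and lim: "\<And>z. (\<lambda>k. of_real (c k) * poly (Ck (r k)) z) \<longlonglongrightarrow> poly D z"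
    using normalized_polys_convergent_subsequence[of Ck n] by blast
  have tr: "(\<lambda>k. t (r k)) \<longlonglongrightarrow> s" using LIMSEQ_subseq_LIMSEQ[OF t(2) r(1)] by (simp add: o_def)
  have scale: "Re (of_real x * y * w) = x * Re (y * w)" for x y w
    by (simp add: algebra_simps)
  have "\<exists>E. degree E \<le> n \<and> (\<forall>z\<in>sphere 0 1.
           Re (poly E z * cnj (poly A z)) > 0 \<and> Re (poly E z * cnj (poly (F s) z)) > 0)"
  proof (rule strict_perturbation[OF deg(1) degF r(4) _ r(3)])
    fix u z assume u: "u \<in> {0..1::real}" and z: "z \<in> cball (0::complex) 1"
    have "u * s \<in> {0..1}" using u s by (auto intro: mult_le_one)
    from seg[OF this z]
    show "of_real (1 - u) * poly A z + of_real u * poly (F s) z \<noteq> 0"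
      by (simp add: F_def algebra_simps)
  next
    fix z assume z: "z \<in> sphere (0::complex) 1"
    show "Re (poly D z * cnj (poly A z)) \<ge> 0"
    proof (rule LIMSEQ_le_const)
      show "(\<lambda>k. Re (of_real (c k) * poly (Ck (r k)) z * cnj (poly A z))) \<longlonglongrightarrow> Re (poly D z * cnj (poly A z))"
        by (intro tendsto_intros lim)
      show "\<exists>N. \<forall>k\<ge>N. 0 \<le> Re (of_real (c k) * poly (Ck (r k)) z * cnj (poly A z))"
        unfolding scale using Ck z r(2) by (auto simp: ok_def less_imp_le simp del: times_complex.sel)
    qed
    show "Re (poly D z * cnj (poly (F s) z)) \<ge> 0"
    proof (rule LIMSEQ_le_const)
      have "(\<lambda>k. of_real (1 - t (r k)) * poly A z + of_real (t (r k)) * poly B z)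
          \<longlonglongrightarrow> of_real (1 - s) * poly A z + of_real s * poly B z"
        by (intro tendsto_intros tr)
      hence "(\<lambda>k. poly (F (t (r k))) z) \<longlonglongrightarrow> poly (F s) z" by (simp add: F_def)
      thus "(\<lambda>k. Re (of_real (c k) * poly (Ck (r k)) z * cnj (poly (F (t (r k))) z)))
          \<longlonglongrightarrow> Re (poly D z * cnj (poly (F s) z))"
        by (intro tendsto_intros lim)
      show "\<exists>N. \<forall>k\<ge>N. 0 \<le> Re (of_real (c k) * poly (Ck (r k)) z * cnj (poly (F (t (r k))) z))"
        unfolding scale using Ck z r(2) by (auto simp: ok_def less_imp_le simp del: times_complex.sel)
    qed
  qed
  then obtain E where E: "ok s E" unfolding ok_def by blast
  have "s = 1"
  proof (rule ccontr)
    assume "s \<noteq> 1"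
    hence s1: "s < 1" using s by simp
    have "\<exists>e0>0. \<forall>e z. 0 < e \<and> e < e0 \<and> z \<in> sphere 0 1 \<longrightarrow>
        Re (poly E z * cnj (poly (F s) z)) + e * Re (poly E z * cnj (poly (B - A) z)) > 0"
    proof (intro add_small_multiple_pos_on_compact continuous_intros)
      fix z assume "z \<in> sphere (0::complex) 1"
      hence "Re (poly E z * cnj (poly (F s) z)) > 0" using E unfolding ok_def by blast
      thus "0 \<le> Re (poly E z * cnj (poly (F s) z))"
        "Re (poly E z * cnj (poly (F s) z)) = 0 \<Longrightarrow> 0 < Re (poly E z * cnj (poly (B - A) z))"
        by linarith+
    qed simp
    then obtain e0 where e0: "e0 > 0" "\<And>e z. 0 < e \<Longrightarrow> e < e0 \<Longrightarrow> z \<in> sphere 0 1 \<Longrightarrow>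
        Re (poly E z * cnj (poly (F s) z)) + e * Re (poly E z * cnj (poly (B - A) z)) > 0" by blast
    define e where "e = min (e0 / 2) (1 - s)"
    have e: "0 < e" "e < e0" "s + e \<le> 1" using e0(1) s1 by (auto simp: e_def)
    have "Re (poly E z * cnj (poly (F (s + e)) z))
        = Re (poly E z * cnj (poly (F s) z)) + e * Re (poly E z * cnj (poly (B - A) z))" for z
      by (simp add: F_def algebra_simps)
    hence "ok (s + e) E" using E e0(2)[OF e(1,2)] unfolding ok_def by simp
    hence "s + e \<in> S" using s e by (auto simp: S_def)
    hence "s + e \<le> s" unfolding s_def using bdd by (rule cSup_upper)
    thus False using e(1) by simp
  qed
  thus ?thesis using E unfolding ok_def F1[symmetric] by blast
qed

section \<open>The Cayley transform\<close>

text \<open>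
  The homogenization of \<open>p\<close> as a binary form of degree \<open>n\<close>, evaluated at \<open>(q, r)\<close>. With linear \<open>q\<close>
  and \<open>r\<close> it is the action of a fractional linear map, and both directions of the Cayley transform are
  instances.
\<close>

definition homogeneous_subst :: "nat \<Rightarrow> complex poly \<Rightarrow> complex poly \<Rightarrow> complex poly \<Rightarrow> complex poly" where
  "homogeneous_subst n p q r = (\<Sum>k\<le>n. smult (coeff p k) (q ^ k * r ^ (n - k)))"

lemma degree_homogeneous_subst:
  assumes "degree q \<le> 1" "degree r \<le> 1"
  shows "degree (homogeneous_subst n p q r) \<le> n"
  unfolding homogeneous_subst_def
proof (intro degree_sum_le)
  fix k assume "k \<in> {..n}"
  hence k: "k \<le> n" by simp
  have "degree (q ^ k) \<le> 1 * k" "degree (r ^ (n - k)) \<le> 1 * (n - k)"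
    using assms by (meson degree_power_le order_trans mult_le_mono1)+
  hence "degree (q ^ k * r ^ (n - k)) \<le> n"
    using degree_mult_le[of "q ^ k" "r ^ (n - k)"] k by linarith
  thus "degree (smult (coeff p k) (q ^ k * r ^ (n - k))) \<le> n"
    using degree_smult_le order_trans by blast
qed simp

lemma poly_homogeneous_subst:
  assumes "degree p \<le> n" "poly r z \<noteq> 0"
  shows "poly (homogeneous_subst n p q r) z = poly r z ^ n * poly p (poly q z / poly r z)"
proof -
  have eq: "poly r z ^ n * (coeff p k * (poly q z / poly r z) ^ k)
      = coeff p k * (poly q z ^ k * poly r z ^ (n - k))" if "k \<le> n" for k
  proof -
    have "poly r z ^ n = poly r z ^ k * poly r z ^ (n - k)" using that by (simp add: power_add[symmetric])
    thus ?thesis using assms(2) by (simp add: power_divide)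
  qed
  show ?thesis
    unfolding homogeneous_subst_def poly_as_sum_atMost[OF assms(1)] sum_distrib_left poly_sum
    by (intro sum.cong refl) (simp only: poly_smult poly_mult poly_power eq atMost_iff)
qed

definition to_disc :: "nat \<Rightarrow> complex poly \<Rightarrow> complex poly" where
  "to_disc n p = homogeneous_subst n p [:1, 1:] [:1, -1:]"

definition to_halfplane :: "nat \<Rightarrow> complex poly \<Rightarrow> complex poly" where
  "to_halfplane n p = homogeneous_subst n p [:-1, 1:] [:1, 1:]"

lemma poly_to_disc:
  assumes "degree p \<le> n" "z \<noteq> 1"
  shows "poly (to_disc n p) z = (1 - z) ^ n * poly p ((1 + z) / (1 - z))"
proof -
  have "poly [:1, 1:] z = 1 + z" "poly [:1, -1:] z = 1 - z" by simp_all
  moreover have "1 - z \<noteq> 0" using assms(2) by simp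
  ultimately show ?thesis
    using poly_homogeneous_subst[OF assms(1), of "[:1, -1:]" z "[:1, 1:]"] by (simp only: to_disc_def simp_thms True_implies_equals)
qed

text \<open>
  The point \<open>z = 1\<close> corresponds to \<open>s = \<infinity>\<close> and sees only the coefficient of \<open>s^n\<close>.
\<close>

lemma poly_to_disc_1: "poly (to_disc n p) 1 = 2 ^ n * coeff p n"
proof -
  have "poly (to_disc n p) 1 = (\<Sum>k\<le>n. if k = n then 2 ^ n * coeff p n else 0)"
    unfolding to_disc_def homogeneous_subst_def poly_sum
    by (intro sum.cong) (auto simp: power_0_left)
  thus ?thesis by simp
qed

lemma poly_to_halfplane:
  assumes "degree p \<le> n" "s \<noteq> -1"
  shows "poly (to_halfplane n p) s = (s + 1) ^ n * poly p ((s - 1) / (s + 1))"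
proof -
  have "s + 1 \<noteq> 0" using assms(2) by (simp add: add_eq_0_iff2)
  thus ?thesis
    using poly_homogeneous_subst[of p n "[:1, 1:]" s "[:-1, 1:]"] assms by (simp add: to_halfplane_def add.commute)
qed

lemma coeff_to_halfplane:
  assumes "degree p \<le> n"
  shows "coeff (to_halfplane n p) n = poly p 1"
proof -
  have "coeff ([:-1, 1:] ^ k * [:1, 1:] ^ (n - k)) n = (1::complex)" if "k \<le> n" for k
  proof -
    have "degree ([:-1, 1:] ^ k * [:1, 1:] ^ (n - k) :: complex poly) = n"
      using that by (subst degree_mult_eq) (auto simp: degree_power_eq)
    moreover have "lead_coeff ([:-1, 1:] ^ k * [:1, 1:] ^ (n - k) :: complex poly) = 1"
      by (simp add: lead_coeff_mult lead_coeff_power)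
    ultimately show ?thesis by simp
  qed
  thus ?thesis
    by (simp add: to_halfplane_def homogeneous_subst_def coeff_sum poly_as_sum_atMost[OF assms])
qed

lemma Re_cayley: "Re ((1 + z) / (1 - z)) = (1 - (cmod z)\<^sup>2) / (cmod (1 - z))\<^sup>2"
proof -
  have "Re (1 + z) * Re (1 - z) + Im (1 + z) * Im (1 - z) = 1 - (cmod z)\<^sup>2"
    unfolding cmod_power2 by (simp add: power2_eq_square algebra_simps)
  thus ?thesis by (simp only: Re_divide cmod_power2)
qed

lemma cayley_inverse:
  fixes s :: complex
  assumes "Re s \<ge> 0"
  defines "z \<equiv> (s - 1) / (s + 1)"
  shows "s + 1 \<noteq> 0" "z \<noteq> 1" "1 - z = 2 / (s + 1)" "(1 + z) / (1 - z) = s" "z \<in> cball 0 1"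
    "Re s = 0 \<Longrightarrow> z \<in> sphere 0 1"
proof -
  show s: "s + 1 \<noteq> 0" using assms(1) by (auto simp: complex_eq_iff)
  show d: "1 - z = 2 / (s + 1)" using s by (simp add: z_def field_simps)
  thus z1: "z \<noteq> 1" using s by auto
  have "1 + z = 2 * s / (s + 1)" using s by (simp add: z_def field_simps)
  thus c: "(1 + z) / (1 - z) = s" using s by (simp add: d)
  have pos: "(cmod (1 - z))\<^sup>2 > 0" using z1 by simp
  have Re_s: "Re s = (1 - (cmod z)\<^sup>2) / (cmod (1 - z))\<^sup>2" using Re_cayley[of z] c by simp
  hence "(cmod z)\<^sup>2 \<le> 1\<^sup>2" using assms(1) pos by (simp add: zero_le_divide_iff)
  thus "z \<in> cball 0 1" using power2_le_imp_le[of "cmod z" 1] by simp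
  show "z \<in> sphere 0 1" if "Re s = 0"
  proof -
    have "(cmod z)\<^sup>2 = 1\<^sup>2" using Re_s that pos by (simp add: divide_eq_0_iff)
    thus ?thesis using power2_eq_imp_eq[of "cmod z" 1] by simp
  qed
qed

lemma Re_mult_cnj_to_disc:
  assumes "degree p \<le> n" "degree q \<le> n" "z \<noteq> 1"
  shows "Re (poly (to_disc n p) z * cnj (poly (to_disc n q) z))
       = (cmod (1 - z)) ^ (2 * n) * Re (poly p ((1 + z) / (1 - z)) * cnj (poly q ((1 + z) / (1 - z))))"
proof -
  have "poly (to_disc n p) z * cnj (poly (to_disc n q) z)
      = ((1 - z) * cnj (1 - z)) ^ n * (poly p ((1 + z) / (1 - z)) * cnj (poly q ((1 + z) / (1 - z))))"
    using assms by (simp add: poly_to_disc power_mult_distrib)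
  also have "((1 - z) * cnj (1 - z)) ^ n = of_real ((cmod (1 - z)) ^ (2 * n))"
    by (simp only: complex_norm_square[symmetric] power_mult of_real_power)
  finally show ?thesis by (simp only: times_complex.sel Re_complex_of_real Im_complex_of_real)
qed

section \<open>Hurwitz polynomials and strict positive realness on the disc\<close>

abbreviation cpoly :: "real poly \<Rightarrow> complex poly" where
  "cpoly p \<equiv> map_poly complex_of_real p"

lemma degree_cpoly: "degree (cpoly p) = degree p"
  by (intro degree_map_poly) auto

lemma cpoly_combination: "cpoly (smult x p + smult y q) = smult (of_real x) (cpoly p) + smult (of_real y) (cpoly q)"
  by (intro poly_eqI) (simp add: coeff_map_poly)

lemma to_disc_combination: "to_disc n (smult x p + smult y q) = smult x (to_disc n p) + smult y (to_disc n q)"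
  unfolding to_disc_def homogeneous_subst_def
  by (intro poly_eqI) (simp add: coeff_sum sum_distrib_left sum.distrib distrib_right mult.assoc)

lemma ceval_cnj: "ceval p (cnj s) = cnj (ceval p s)"
  by (simp add: ceval_def poly_altdef coeff_map_poly)

text \<open>
  At \<open>z = 1\<close> this expresses that the degree of \<open>p\<close> is not less than \<open>n\<close>.
\<close>

lemma to_disc_hurwitz_nonzero:
  assumes p: "p \<in> hurwitz_polys n" and z: "z \<in> cball 0 1"
  shows "poly (to_disc n (cpoly p)) z \<noteq> 0"
proof -
  have deg: "degree p = n" and roots: "\<And>s. ceval p s = 0 \<Longrightarrow> Re s < 0"
    using p by (auto simp: hurwitz_polys_def polys_of_degree_def)
  show ?thesis
  proof (cases "z = 1")
    case True
    have "p \<noteq> 0" using roots[of 0] by (auto simp: ceval_def)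
    hence "coeff p n \<noteq> 0" using deg by auto
    thus ?thesis by (simp add: True poly_to_disc_1 coeff_map_poly)
  next
    case False
    have "(cmod z)\<^sup>2 \<le> 1" using z by (simp add: power_le_one)
    hence "Re ((1 + z) / (1 - z)) \<ge> 0" unfolding Re_cayley by simp
    hence "ceval p ((1 + z) / (1 - z)) \<noteq> 0" using roots by (metis not_less)
    thus ?thesis using False deg by (simp add: poly_to_disc degree_cpoly ceval_def)
  qed
qed

text \<open>
  Away from \<open>z = 1\<close> this is the definition. At \<open>z = 1\<close> continuity gives a weak inequality, and
  equality is excluded because \<open>c\<close> has the same degree as \<open>a\<close>.
\<close>

lemma strictly_positive_real_to_disc:
  assumes spr: "strictly_positive_real c a" and deg: "degree a = n" and monic: "lead_coeff a = 1"
    and z: "z \<in> sphere 0 1"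
  shows "Re (poly (to_disc n (cpoly c)) z * cnj (poly (to_disc n (cpoly a)) z)) > 0"
proof -
  define h where "h w = Re (poly (to_disc n (cpoly c)) w * cnj (poly (to_disc n (cpoly a)) w))" for w
  have degc: "degree c = n" using spr deg by (simp add: strictly_positive_real_def)
  have pos: "h w > 0" if w: "cmod w = 1" "w \<noteq> 1" for w
  proof -
    define s where "s = (1 + w) / (1 - w)"
    have "Re s = 0" unfolding s_def Re_cayley using w by simp
    hence "s = \<i> * of_real (Im s)" by (simp add: complex_eq_iff)
    hence "Re (ceval c s / ceval a s) > 0" using spr unfolding strictly_positive_real_def by metis
    hence "Re (poly (cpoly c) s * cnj (poly (cpoly a) s)) > 0"
      by (simp only: Re_complex_div_gt_0 ceval_def)
    moreover have "cmod (1 - w) ^ (2 * n) > 0" using w by simp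
    moreover have "h w = cmod (1 - w) ^ (2 * n) * Re (poly (cpoly c) s * cnj (poly (cpoly a) s))"
      unfolding h_def s_def using w degc deg by (intro Re_mult_cnj_to_disc) (simp_all add: degree_cpoly)
    ultimately show ?thesis by (simp only: mult_pos_pos)
  qed
  show "h z > 0"
  proof (cases "z = 1")
    case True
    have "h 1 \<ge> 0"
    proof (rule tendsto_lowerbound)
      have "((\<lambda>t. cis t) \<longlongrightarrow> cis 0) (at_right 0)" by (intro tendsto_intros)
      hence lim: "((\<lambda>t. cis t) \<longlongrightarrow> 1) (at_right 0)" by simp
      show "((\<lambda>t. h (cis t)) \<longlongrightarrow> h 1) (at_right 0)"
        unfolding h_def by (intro tendsto_intros isCont_tendsto_compose[OF poly_isCont lim])
      have "\<forall>\<^sub>F t in at_right 0. t \<in> {0<..<pi}" by (rule eventually_at_right_real) simp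
      thus "\<forall>\<^sub>F t in at_right 0. h (cis t) \<ge> 0"
      proof eventually_elim
        case (elim t)
        hence "Im (cis t) \<noteq> Im 1" using sin_gt_zero[of t] by simp
        hence "cis t \<noteq> 1" by metis
        thus ?case using pos[of "cis t"] by simp
      qed
    qed simp
    moreover have "h 1 = (2 ^ n * 2 ^ n) * coeff c n"
    proof -
      have "poly (to_disc n (cpoly c)) 1 * cnj (poly (to_disc n (cpoly a)) 1) = of_real ((2 ^ n * 2 ^ n) * coeff c n)"
        using monic deg by (simp add: poly_to_disc_1 coeff_map_poly)
      thus ?thesis unfolding h_def by (simp only: Re_complex_of_real)
    qed
    moreover have "coeff c n \<noteq> 0"
    proof
      assume "coeff c n = 0"
      hence "c = 0" using degc by auto
      moreover have "Re (ceval c (\<i> * of_real 0) / ceval a (\<i> * of_real 0)) > 0"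
        using spr unfolding strictly_positive_real_def by blast
      ultimately show False by (simp add: ceval_def)
    qed
    ultimately have "h 1 \<ge> 0" "h 1 \<noteq> 0" by simp_all
    thus ?thesis unfolding True by linarith
  qed (use pos z in simp)
qed

text \<open>
  A zero of the convex combination in the closed right half-plane would make
  \<open>(1 - l) * Re (C * cnj A) + l * Re (C * cnj B)\<close> vanish at a point of the disc, where both real parts
  are positive by the maximum principle.
\<close>

lemma common_multiplier_imp_stable_segment:
  assumes a: "a \<in> hurwitz_polys n" "lead_coeff a = 1" and b: "b \<in> hurwitz_polys n" "lead_coeff b = 1"
    and c: "strictly_positive_real c a" "strictly_positive_real c b" and l: "l \<in> {0..1}"
  shows "smult l b + smult (1 - l) a \<in> hurwitz_polys n"
proof -
  have deg: "degree a = n" "degree b = n" using a b by (auto simp: hurwitz_polys_def polys_of_degree_def)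
  define q where "q = smult l b + smult (1 - l) a"
  have "coeff q n = 1" using a b deg by (simp add: q_def)
  moreover have degq: "degree q \<le> n"
    unfolding q_def using deg degree_smult_le[of l b] degree_smult_le[of "1 - l" a] by (intro degree_add_le) auto
  ultimately have "degree q = n" using le_degree[of q n] by simp
  moreover have "Re s < 0" if root: "ceval q s = 0" for s
  proof (rule ccontr)
    assume "\<not> Re s < 0"
    hence s: "Re s \<ge> 0" by simp
    define z where "z = (s - 1) / (s + 1)"
    note z = cayley_inverse[OF s, folded z_def]
    define A B C where "A = poly (to_disc n (cpoly a)) z" and "B = poly (to_disc n (cpoly b)) z"
      and "C = poly (to_disc n (cpoly c)) z"
    have "Re (C * cnj A) > 0" unfolding C_def A_def
      by (rule Re_mult_cnj_pos_on_disc[OF to_disc_hurwitz_nonzero[OF a(1)] _ z(5)])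
        (use strictly_positive_real_to_disc[OF c(1) deg(1) a(2)] in blast)+
    moreover have "Re (C * cnj B) > 0" unfolding C_def B_def
      by (rule Re_mult_cnj_pos_on_disc[OF to_disc_hurwitz_nonzero[OF b(1)] _ z(5)])
        (use strictly_positive_real_to_disc[OF c(2) deg(2) b(2)] in blast)+
    ultimately have "(1 - l) * Re (C * cnj A) + l * Re (C * cnj B) > 0"
      using l by (cases "l = 0") (auto intro!: add_nonneg_pos simp del: times_complex.sel)
    moreover have "poly (to_disc n (cpoly q)) z = (1 - z) ^ n * ceval q s"
      using poly_to_disc[of "cpoly q" n z] degq z(2,4) by (simp add: degree_cpoly ceval_def)
    hence "of_real l * B + of_real (1 - l) * A = 0"
      unfolding q_def cpoly_combination to_disc_combination A_def B_def using root[unfolded q_def] by simp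
    hence "Re (C * cnj (of_real l * B + of_real (1 - l) * A)) = 0" by simp
    hence "(1 - l) * Re (C * cnj A) + l * Re (C * cnj B) = 0" by (simp add: algebra_simps)
    ultimately show False by simp
  qed
  ultimately show ?thesis by (simp add: q_def hurwitz_polys_def polys_of_degree_def)
qed

text \<open>
  Taking real parts of the coefficients averages \<open>p\<close> with its mirror image under complex conjugation of
  the plane, which maps the imaginary axis to itself.
\<close>

lemma ceval_Re_part:
  "2 * ceval (map_poly Re p) s = poly p s + cnj (poly p (cnj s))"
proof -
  have "smult 2 (cpoly (map_poly Re p)) = p + map_poly cnj p"
    by (intro poly_eqI) (simp add: coeff_map_poly complex_eq_iff)
  hence "2 * ceval (map_poly Re p) s = poly (p + map_poly cnj p) s"
    unfolding ceval_def by (metis poly_smult)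
  moreover have "degree (map_poly cnj p) = degree p" by (intro degree_map_poly) auto
  hence "poly (map_poly cnj p) s = cnj (poly p (cnj s))"
    by (simp add: poly_altdef coeff_map_poly)
  ultimately show ?thesis by simp
qed

text \<open>
  The multiplier \<open>C\<close> found on the circle is carried back to \<open>H\<close> on the half-plane, and \<open>c\<close> is its real
  part. The condition at \<open>z = 1\<close> says that the coefficient of \<open>s^n\<close> in \<open>H\<close> has positive real part, so
  that \<open>c\<close> has degree exactly \<open>n\<close>.
\<close>

lemma stable_segment_imp_common_multiplier:
  assumes a: "a \<in> hurwitz_polys n" "lead_coeff a = 1" and b: "b \<in> hurwitz_polys n" "lead_coeff b = 1"
    and seg: "\<And>l. l \<in> {0..1} \<Longrightarrow> smult l b + smult (1 - l) a \<in> hurwitz_polys n"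
  shows "\<exists>c. strictly_positive_real c a \<and> strictly_positive_real c b"
proof -
  have deg: "degree a = n" "degree b = n" using a b by (auto simp: hurwitz_polys_def polys_of_degree_def)
  have dtd: "degree (to_disc n p) \<le> n" for p
    unfolding to_disc_def by (rule degree_homogeneous_subst) auto
  obtain C where C: "degree C \<le> n" and
    CA: "\<And>z. z \<in> sphere 0 1 \<Longrightarrow> Re (poly C z * cnj (poly (to_disc n (cpoly a)) z)) > 0" and
    CB: "\<And>z. z \<in> sphere 0 1 \<Longrightarrow> Re (poly C z * cnj (poly (to_disc n (cpoly b)) z)) > 0"
  proof -
    have "of_real (1 - t) * poly (to_disc n (cpoly a)) z + of_real t * poly (to_disc n (cpoly b)) z \<noteq> 0"
      if "t \<in> {0..1}" "z \<in> cball 0 1" for t z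
      using to_disc_hurwitz_nonzero[OF seg[OF that(1)] that(2)]
      unfolding cpoly_combination to_disc_combination by (simp add: add.commute)
    from common_multiplier_on_circle[OF dtd dtd this] that show ?thesis by blast
  qed
  define H where "H = to_halfplane n C"
  define c where "c = map_poly Re H"
  have degH: "degree H \<le> n"
    unfolding H_def to_halfplane_def by (rule degree_homogeneous_subst) auto
  have "Re (poly C 1 * cnj (2 ^ n)) > 0"
    using CA[of 1] a(2) deg by (simp add: poly_to_disc_1 coeff_map_poly del: times_complex.sel)
  hence "Re (poly C 1 * of_real (2 ^ n)) > 0" by (simp del: times_complex.sel)
  hence "Re (poly C 1) > 0" by (simp only: Re_complex_of_real Im_complex_of_real times_complex.sel) (simp add: zero_less_mult_iff)
  hence "coeff c n \<noteq> 0" by (simp add: c_def coeff_map_poly H_def coeff_to_halfplane[OF C])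
  moreover have "degree c \<le> n" 
    unfolding c_def using degH by (intro degree_le) (simp add: coeff_map_poly coeff_eq_0)
  ultimately have degc: "degree c = n" using le_degree[of c n] by simp
  have pos: "Re (ceval c (\<i> * of_real \<omega>) / ceval p (\<i> * of_real \<omega>)) > 0"
    if p: "degree p = n"
      "\<And>z. z \<in> sphere 0 1 \<Longrightarrow> Re (poly C z * cnj (poly (to_disc n (cpoly p)) z)) > 0" for p \<omega>
  proof -
    have H: "Re (poly H s * cnj (ceval p s)) > 0" if s: "Re s = 0" for s
    proof -
      define z where "z = (s - 1) / (s + 1)"
      have "Re s \<ge> 0" using s by simp
      note z = cayley_inverse[OF this, folded z_def]
      have H_s: "poly H s = (s + 1) ^ n * poly C z"
        unfolding H_def z_def using z(1) by (intro poly_to_halfplane[OF C]) auto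
      have "poly (to_disc n (cpoly p)) z = (2 / (s + 1)) ^ n * ceval p s"
        using poly_to_disc[of "cpoly p" n z] p(1) z(2,3,4) by (simp add: degree_cpoly ceval_def)
      hence p_s: "2 ^ n * ceval p s = (s + 1) ^ n * poly (to_disc n (cpoly p)) z"
        using z(1) by (simp add: power_divide)
      have "poly H s * cnj (2 ^ n * ceval p s)
          = ((s + 1) * cnj (s + 1)) ^ n * (poly C z * cnj (poly (to_disc n (cpoly p)) z))"
        unfolding p_s H_s by (simp only: complex_cnj_mult complex_cnj_power power_mult_distrib mult_ac)
      also have "((s + 1) * cnj (s + 1)) ^ n = of_real (((cmod (s + 1))\<^sup>2) ^ n)"
        by (simp only: complex_norm_square[symmetric] of_real_power)
      finally have "of_real (2 ^ n) * (poly H s * cnj (ceval p s))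
          = of_real (((cmod (s + 1))\<^sup>2) ^ n) * (poly C z * cnj (poly (to_disc n (cpoly p)) z))"
        by (simp add: mult_ac)
      moreover have re_scale: "Re (of_real x * w) = x * Re w" for x w by simp
      ultimately have "2 ^ n * Re (poly H s * cnj (ceval p s))
          = ((cmod (s + 1))\<^sup>2) ^ n * Re (poly C z * cnj (poly (to_disc n (cpoly p)) z))"
        by (metis re_scale)
      also have "\<dots> > 0" using z(1) s by (intro mult_pos_pos p(2) z(6)) auto
      finally show ?thesis by (simp only: zero_less_mult_iff) simp
    qed
    define s where "s = \<i> * complex_of_real \<omega>"
    have "2 * (ceval c s * cnj (ceval p s)) = (poly H s + cnj (poly H (cnj s))) * cnj (ceval p s)"
      unfolding c_def by (simp only: ceval_Re_part[symmetric] mult.assoc)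
    also have "\<dots> = poly H s * cnj (ceval p s) + cnj (poly H (cnj s) * cnj (ceval p (cnj s)))"
      by (simp add: ceval_cnj algebra_simps)
    finally have "Re (2 * (ceval c s * cnj (ceval p s)))
        = Re (poly H s * cnj (ceval p s)) + Re (poly H (cnj s) * cnj (ceval p (cnj s)))" by (simp only:) simp
    also have "\<dots> > 0" by (intro add_pos_pos H) (simp_all add: s_def)
    finally have "Re (ceval c s * cnj (ceval p s)) > 0" by simp
    thus ?thesis by (simp only: s_def Re_complex_div_gt_0)
  qed
  have "strictly_positive_real c a" "strictly_positive_real c b"
    unfolding strictly_positive_real_def using degc deg a b pos[OF deg(1) CA] pos[OF deg(2) CB] by auto
  thus ?thesis by blast
qed

theorem theorem1:
  fixes n :: nat and a b :: "real poly"
  assumes "n \<ge> 1"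
    and "a \<in> hurwitz_polys n" and "lead_coeff a = 1"
    and "b \<in> hurwitz_polys n" and "lead_coeff b = 1"
  shows "(\<exists>c :: real poly. strictly_positive_real c a \<and> strictly_positive_real c b) \<longleftrightarrow>
         (\<forall>l\<in>{0..1::real}. smult l b + smult (1 - l) a \<in> hurwitz_polys n)"
  using common_multiplier_imp_stable_segment[OF assms(2-5)]
    stable_segment_imp_common_multiplier[OF assms(2-5)] by blast

end
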